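(* Let $k$ be a field, $I\subseteq R=k[x_1,\dots,x_n]$ an ideal, and $\prec_1,\prec_2$ rational term orders given by $\mathbb{Q}$-bases $\omega=(\omega_1,\dots,\omega_n)$ and $\tau=(\tau_1,\dots,\tau_n)$ of $\mathbb{Q}^n$, respectively. Let the facet preorder $\prec$ on $\partial(I)\cap C_{\prec_1,\prec_2}$ be as defined in the context. Then the following algorithm (the generic Gröbner walk) terminates and is correct: given as input the marked reduced Gröbner basis $G$ of $I$ over $\prec_1$ together with $\prec_1$ and $\prec_2$, it outputs the reduced Gröbner basis of $I$ over $\prec_2$. (i) Put $w:=-\infty$. (ii) Let $V:=\{v\in\partial(G)\cap C_{\prec_1,\prec_2}\mid w\prec v\}$. If $V=\emptyset$, output $G$ and halt. Otherwise let $w$ be a $\prec$-minimal element of $V$ (any one, if there are several). (iii) For each $g=\sum_v a_vx^v\in G$ with marked term $a_ux^u$ form $g_w=a_ux^u+\sum_{v\in S_g}a_vx^v$, where $S_g$ is the set of $v\in\operatorname{supp}(g)\setminus\{u\}$ such that $u-v\in C_{\prec_1,\prec_2}$ and neither $u-v\prec w$ nor $w\prec u-v$ holds. (iv) Compute the reduced Gröbner basis $H$ over $\prec_2$ of the ideal generated by $\{g_w\mid g\in G\}$, and mark each element of $H$ at its initial term with respect to $\prec_2$. (v) Let $H'=\{f-f^G\mid f\in H\}$, where $f^G$ is the remainder of $f$ on division by the marked Gröbner basis $G$; mark $f-f^G$ at the marked term of $f$. (vi) Autoreduce $H'$ with respect to its marking (that is, replace elements by their reductions modulo the others until no marked term divides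 any term of another element) and let $G$ be the resulting marked set. (vii) Repeat from (ii).
   Context: Group orders and term orders: a group order on $\mathbb{Q}^n$ is a total order $\prec$ with $x\prec y\Rightarrow x+z\prec y+z$. The rational group order given by a $\mathbb{Q}$-basis $\omega=(\omega_1,\dots,\omega_n)$ of $\mathbb{Q}^n$ is: $u\prec v$ iff $(\langle\omega_1,u\rangle,\dots,\langle\omega_n,u\rangle)$ is lexicographically smaller than $(\langle\omega_1,v\rangle,\dots,\langle\omega_n,v\rangle)$. It is a term order if $0\prec e_i$ for every canonical basis vector $e_i$. The same formula is used to compare vectors of $\mathbb{R}^n$. Polynomials: for $f=\sum_v a_vx^v\ne0$ let $\operatorname{supp}(f)=\{v\in\mathbb{N}^n\mid a_v\neq0\}$ and $\operatorname{in}_\prec(f)=a_ux^u$ with $u=\max_\prec\operatorname{supp}(f)$. A marked polynomial is a polynomial with a distinguished term, which is its initial term with respect to some term order; a marked Gröbner basis over a term order is a Gröbner basis with all initial terms marked. For a marked polynomial $f$ with marked term $a_ux^u$, $\partial(f)=\{u-u'\mid u'\in\operatorname{supp}(f)\setminus\{u\}\}\subset\mathbb{Z}^n$, and $\partial(G)=\bigcup_{f\in G}\partial(f)$. $\partial(I)$ denotes the union of the sets $\partial(G)$ over the finitely many (marked) reduced Gröbner bases $G$ of $I$, for all term orders. Reduced Gröbner bases are monic with respect to their marked terms. Let $C_{\prec_1,\prec_2}=\{v\in\mathbb{R}^n\mid 0\prec_1v\text{ and }v\prec_20\}$. Facet preorder: let $T$ be the $n\times n$ matrix with rows $\tau_1,\dots,\tau_n$.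 For column vectors $u,v\in\partial(I)\cap C_{\prec_1,\prec_2}$ put $u\prec v$ iff $Tuv^t\prec_1Tvu^t$, where the two $n\times n$ matrices are compared lexicographically row by row (first row first), with rows compared using $\prec_1$; row $i$ of $Tuv^t$ is $\langle\tau_i,u\rangle v$ and row $i$ of $Tvu^t$ is $\langle\tau_i,v\rangle u$. The symbol $-\infty$ satisfies $-\infty\prec v$ for all $v\in\partial(I)\cap C_{\prec_1,\prec_2}$. *)

theory Defs
  imports "HOL-Analysis.Analysis" "HOL-Library.Poly_Mapping"
begin

section \<open>Polynomials and ideals\<close>

type_synonym 'n expo = "'n \<Rightarrow>\<^sub>0 nat"
type_synonym ('n, 'k) mpoly = "'n expo \<Rightarrow>\<^sub>0 'k"

text \<open>A marked polynomial is a pair of the exponent of its marked term and the polynomial.\<close>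

type_synonym ('n, 'k) marked = "'n expo \<times> ('n, 'k) mpoly"

text \<open>The ring as a module over itself: \<open>ideal.subspace I\<close> says that \<open>I\<close> is an ideal,
  and \<open>ideal.span S\<close> is the ideal generated by \<open>S\<close>.\<close>

global_interpretation ideal: module "(*) :: 'a::comm_ring_1 \<Rightarrow> 'a \<Rightarrow> 'a"
  by standard (simp_all add: algebra_simps)

definition expo_vec :: "'n expo \<Rightarrow> 'a::semiring_1 ^ 'n::finite" where
  "expo_vec u = (\<chi> i. of_nat (Poly_Mapping.lookup u i))"

definition expo_dvd :: "'n expo \<Rightarrow> 'n expo \<Rightarrow> bool" where
  "expo_dvd u a \<longleftrightarrow> (\<exists>b. a = u + b)"


section \<open>Group orders and term orders\<close>

text \<open>Orders are represented by their strict part.\<close>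

definition group_order :: "(rat ^ 'n::finite \<Rightarrow> rat ^ 'n \<Rightarrow> bool) \<Rightarrow> bool" where
  "group_order lt \<longleftrightarrow> irreflp lt \<and> transp lt \<and> totalp lt \<and>
     (\<forall>x y z. lt x y \<longrightarrow> lt (x + z) (y + z))"

definition term_order :: "(rat ^ 'n::finite \<Rightarrow> rat ^ 'n \<Rightarrow> bool) \<Rightarrow> bool" where
  "term_order lt \<longleftrightarrow> group_order lt \<and> (\<forall>i. lt 0 (axis i 1))"

definition rat_basis :: "(rat ^ 'n::finite) list \<Rightarrow> bool" where
  "rat_basis \<omega> \<longleftrightarrow> distinct \<omega> \<and> vec.independent (set \<omega>) \<and> vec.span (set \<omega>) = UNIV"

definition pairing :: "rat ^ 'n::finite \<Rightarrow> 'a::linordered_field ^ 'n \<Rightarrow> 'a" where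
  "pairing p u = (\<Sum>i\<in>UNIV. of_rat (p $ i) * u $ i)"

text \<open>Polymorphic, so that the same formula compares vectors of \<open>rat ^ 'n\<close>
  and of \<open>real ^ 'n\<close>.\<close>

definition rat_order ::
    "(rat ^ 'n::finite) list \<Rightarrow> 'a::linordered_field ^ 'n \<Rightarrow> 'a ^ 'n \<Rightarrow> bool" where
  "rat_order \<omega> u v \<longleftrightarrow>
     (map (\<lambda>p. pairing p u) \<omega>, map (\<lambda>p. pairing p v) \<omega>) \<in> lexord {(a, b). a < b}"


section \<open>Groebner bases\<close>

definition lead_expo ::
    "(rat ^ 'n::finite \<Rightarrow> rat ^ 'n \<Rightarrow> bool) \<Rightarrow> ('n, 'k::field) mpoly \<Rightarrow> 'n expo" where
  "lead_expo lt f = (THE u. u \<in> Poly_Mapping.keys f \<and>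
     (\<forall>v \<in> Poly_Mapping.keys f - {u}. lt (expo_vec v) (expo_vec u)))"

definition initial_term ::
    "(rat ^ 'n::finite \<Rightarrow> rat ^ 'n \<Rightarrow> bool) \<Rightarrow> ('n, 'k::field) mpoly \<Rightarrow> ('n, 'k) mpoly" where
  "initial_term lt f =
     Poly_Mapping.single (lead_expo lt f) (Poly_Mapping.lookup f (lead_expo lt f))"

definition initial_ideal ::
    "(rat ^ 'n::finite \<Rightarrow> rat ^ 'n \<Rightarrow> bool) \<Rightarrow> ('n, 'k::field) mpoly set \<Rightarrow> ('n, 'k) mpoly set"
  where "initial_ideal lt I = ideal.span (initial_term lt ` (I - {0}))"

definition groebner_basis ::
    "(rat ^ 'n::finite \<Rightarrow> rat ^ 'n \<Rightarrow> bool) \<Rightarrow> ('n, 'k::field) mpoly set \<Rightarrow>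
     ('n, 'k) mpoly set \<Rightarrow> bool" where
  "groebner_basis lt I B \<longleftrightarrow> finite B \<and> B \<subseteq> I - {0} \<and>
     ideal.span (initial_term lt ` B) = initial_ideal lt I"

definition reduced_groebner_basis ::
    "(rat ^ 'n::finite \<Rightarrow> rat ^ 'n \<Rightarrow> bool) \<Rightarrow> ('n, 'k::field) mpoly set \<Rightarrow>
     ('n, 'k) mpoly set \<Rightarrow> bool" where
  "reduced_groebner_basis lt I B \<longleftrightarrow> groebner_basis lt I B \<and>
     (\<forall>f\<in>B. Poly_Mapping.lookup f (lead_expo lt f) = 1) \<and>
     (\<forall>f\<in>B. \<forall>g\<in>B - {f}. \<forall>a\<in>Poly_Mapping.keys f. \<not> expo_dvd (lead_expo lt g) a)"

definition marked_reduced_groebner_basis ::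
    "(rat ^ 'n::finite \<Rightarrow> rat ^ 'n \<Rightarrow> bool) \<Rightarrow> ('n, 'k::field) mpoly set \<Rightarrow>
     ('n, 'k) marked set \<Rightarrow> bool" where
  "marked_reduced_groebner_basis lt I G \<longleftrightarrow>
     (\<exists>B. reduced_groebner_basis lt I B \<and> G = (\<lambda>f. (lead_expo lt f, f)) ` B)"

text \<open>The differences are integer vectors, represented inside \<open>real ^ 'n\<close>.\<close>

definition bd_poly :: "('n::finite, 'k::field) marked \<Rightarrow> (real ^ 'n) set" where
  "bd_poly = (\<lambda>(u, f). {expo_vec u - expo_vec u' | u'. u' \<in> Poly_Mapping.keys f - {u}})"

definition bd_set :: "('n::finite, 'k::field) marked set \<Rightarrow> (real ^ 'n) set" where
  "bd_set G = (\<Union>m\<in>G. bd_poly m)"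

definition bd_ideal :: "('n::finite, 'k::field) mpoly set \<Rightarrow> (real ^ 'n) set" where
  "bd_ideal I = \<Union> {bd_set G | G. \<exists>lt. term_order lt \<and> marked_reduced_groebner_basis lt I G}"


section \<open>Facet preorder\<close>

definition order_cone ::
    "(rat ^ 'n::finite) list \<Rightarrow> (rat ^ 'n) list \<Rightarrow> (real ^ 'n) set" where
  "order_cone \<omega> \<tau> = {v. rat_order \<omega> 0 v \<and> rat_order \<tau> v 0}"

text \<open>The two matrices are given by their lists of rows.\<close>

definition facet_less ::
    "('n::finite, 'k::field) mpoly set \<Rightarrow> (rat ^ 'n) list \<Rightarrow> (rat ^ 'n) list \<Rightarrow>
     real ^ 'n \<Rightarrow> real ^ 'n \<Rightarrow> bool" where
  "facet_less I \<omega> \<tau> u v \<longleftrightarrow>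
     u \<in> bd_ideal I \<inter> order_cone \<omega> \<tau> \<and> v \<in> bd_ideal I \<inter> order_cone \<omega> \<tau> \<and>
     (map (\<lambda>t. pairing t u *s v) \<tau>, map (\<lambda>t. pairing t v *s u) \<tau>)
       \<in> lexord {(x, y). rat_order \<omega> x y}"

text \<open>\<open>None\<close> stands for $-\infty$.\<close>

fun facet_less_opt ::
    "('n::finite, 'k::field) mpoly set \<Rightarrow> (rat ^ 'n) list \<Rightarrow> (rat ^ 'n) list \<Rightarrow>
     (real ^ 'n) option \<Rightarrow> real ^ 'n \<Rightarrow> bool" where
  "facet_less_opt I \<omega> \<tau> None v \<longleftrightarrow> v \<in> bd_ideal I \<inter> order_cone \<omega> \<tau>"
| "facet_less_opt I \<omega> \<tau> (Some w) v \<longleftrightarrow> facet_less I \<omega> \<tau> w v"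


section \<open>Division by marked polynomials\<close>

definition red_step ::
    "('n::finite, 'k::field) marked set \<Rightarrow> ('n, 'k) mpoly \<Rightarrow> ('n, 'k) mpoly \<Rightarrow> bool" where
  "red_step G f f' \<longleftrightarrow> (\<exists>(u, g)\<in>G. \<exists>b. u + b \<in> Poly_Mapping.keys f \<and>
     f' = f - Poly_Mapping.single b (Poly_Mapping.lookup f (u + b) / Poly_Mapping.lookup g u) * g)"

definition is_remainder ::
    "('n::finite, 'k::field) marked set \<Rightarrow> ('n, 'k) mpoly \<Rightarrow> ('n, 'k) mpoly \<Rightarrow> bool" where
  "is_remainder G f r \<longleftrightarrow> (red_step G)\<^sup>*\<^sup>* f r \<and>
     (\<forall>(u, g)\<in>G. \<forall>a\<in>Poly_Mapping.keys r. \<not> expo_dvd u a)"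

definition autoreduced :: "('n::finite, 'k::field) marked set \<Rightarrow> bool" where
  "autoreduced G \<longleftrightarrow> (\<forall>(u, g)\<in>G. \<forall>(u', f)\<in>G - {(u, g)}.
     \<forall>a\<in>Poly_Mapping.keys f. \<not> expo_dvd u a)"

text \<open>One replacement in an autoreduction. Any nonempty chain of reductions is allowed, in
  particular the passage to a remainder modulo the other elements.\<close>

definition autoreduction_step ::
    "('n::finite, 'k::field) marked set \<Rightarrow> ('n, 'k) marked set \<Rightarrow> bool" where
  "autoreduction_step G G' \<longleftrightarrow> (\<exists>(u, f)\<in>G. \<exists>f'. (red_step (G - {(u, f)}))\<^sup>+\<^sup>+ f f' \<and>
     G' = insert (u, f') (G - {(u, f)}))"


section \<open>The generic Groebner walk\<close>

definition walk_candidates ::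
    "('n::finite, 'k::field) mpoly set \<Rightarrow> (rat ^ 'n) list \<Rightarrow> (rat ^ 'n) list \<Rightarrow>
     (real ^ 'n) option \<Rightarrow> ('n, 'k) marked set \<Rightarrow> (real ^ 'n) set" where
  "walk_candidates I \<omega> \<tau> w G =
     {v \<in> bd_set G \<inter> order_cone \<omega> \<tau>. facet_less_opt I \<omega> \<tau> w v}"

definition facet_form ::
    "('n::finite, 'k::field) mpoly set \<Rightarrow> (rat ^ 'n) list \<Rightarrow> (rat ^ 'n) list \<Rightarrow>
     real ^ 'n \<Rightarrow> ('n, 'k) marked \<Rightarrow> ('n, 'k) mpoly" where
  "facet_form I \<omega> \<tau> w = (\<lambda>(u, g).
     Poly_Mapping.single u (Poly_Mapping.lookup g u) +
     (\<Sum>v \<in> {v \<in> Poly_Mapping.keys g - {u}.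
              expo_vec u - expo_vec v \<in> order_cone \<omega> \<tau> \<and>
              \<not> facet_less I \<omega> \<tau> (expo_vec u - expo_vec v) w \<and>
              \<not> facet_less I \<omega> \<tau> w (expo_vec u - expo_vec v)}.
        Poly_Mapping.single v (Poly_Mapping.lookup g v)))"

text \<open>The algorithm as a nondeterministic transition system: \<open>Walk w G\<close> is the state at the
  loop head, \<open>Autored w G\<close> a state inside an autoreduction, and \<open>Output G\<close> a halted state.
  The ideal \<open>I\<close> is a parameter only because it is the domain of the facet preorder.\<close>

datatype ('v, 'm) walk_state =
    Walk "'v option" "'m set"
  | Autored 'v "'m set"
  | Output "'m set"

inductive walk_step ::
    "('n::finite, 'k::field) mpoly set \<Rightarrow> (rat ^ 'n) list \<Rightarrow> (rat ^ 'n) list \<Rightarrow>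
     (real ^ 'n, ('n, 'k) marked) walk_state \<Rightarrow>
     (real ^ 'n, ('n, 'k) marked) walk_state \<Rightarrow> bool"
  for I \<omega> \<tau> where
  halt: "walk_candidates I \<omega> \<tau> w G = {} \<Longrightarrow> walk_step I \<omega> \<tau> (Walk w G) (Output G)"
| cross: "w' \<in> walk_candidates I \<omega> \<tau> w G \<Longrightarrow>
    (\<forall>v \<in> walk_candidates I \<omega> \<tau> w G. \<not> facet_less I \<omega> \<tau> v w') \<Longrightarrow>
    marked_reduced_groebner_basis (rat_order \<tau>)
      (ideal.span (facet_form I \<omega> \<tau> w' ` G)) H \<Longrightarrow>
    (\<forall>(u, f) \<in> H. is_remainder G f (rem f)) \<Longrightarrow>
    H' = (\<lambda>(u, f). (u, f - rem f)) ` H \<Longrightarrow>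
    walk_step I \<omega> \<tau> (Walk w G) (Autored w' H')"
| reduce: "autoreduction_step G G' \<Longrightarrow> walk_step I \<omega> \<tau> (Autored w G) (Autored w G')"
| loop: "autoreduced G \<Longrightarrow> walk_step I \<omega> \<tau> (Autored w G) (Walk (Some w) G)"

end

theory Submission
  imports Defs "HOL-Computational_Algebra.Polynomial" "HOL-Library.Multiset"
begin

text \<open>
  Write \<open>A(v)\<close> and \<open>B(v)\<close> for the vectors \<open>(\<langle>\<omega>\<^sub>i, v\<rangle>)\<^sub>i\<close> and \<open>(\<langle>\<tau>\<^sub>i, v\<rangle>)\<^sub>i\<close>, read as polynomials in
  infinitely large indeterminates \<open>X\<close> and \<open>Y\<close>, where \<open>Y\<close> dominates all powers of \<open>X\<close>. The two
  term orders are then the signs of \<open>A\<close> and \<open>B\<close> in the ordered ring \<open>\<real>[X][Y]\<close>, and the walk follows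
  the segment from \<open>A\<close> to \<open>B\<close>. A vector \<open>w\<close> of the cone, where \<open>A(w) > 0 > B(w)\<close>, changes sign once on
  the segment, at the point at which the functional is proportional to
  \<open>wt w v = A(w) B(v) - A(v) B(w)\<close>. The facet preorder compares the points of crossing:
  \<open>u \<prec> v\<close> means \<open>wt u v > 0\<close> (\<open>facet_less_iff\<close>). Breaking the ties of \<open>wt w\<close> by \<open>A\<close> or by \<open>B\<close>
  gives term orders \<open>before w\<close> and \<open>after w\<close>.

  The loop invariant is that \<open>G\<close> is the reduced Groebner basis for \<open>after w\<close>, or for the source
  order while \<open>w = -\<infinity>\<close>. The minimal choice of
  the next vector \<open>w'\<close> means that no vector of \<open>\<partial>(G)\<close> changes sign between \<open>w\<close> and \<open>w'\<close>, so that \<open>G\<close>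
  is also the basis for \<open>before w'\<close> (\<open>marked_gb_before\<close>). Both \<open>before w'\<close> and \<open>after w'\<close> refine the
  weight \<open>wt w'\<close>, the forms \<open>g\<^sub>w\<^sub>'\<close> are the parts of top weight of the elements of \<open>G\<close>, and they
  generate the ideal of all initial forms of \<open>I\<close>. On homogeneous elements \<open>after w'\<close> agrees with the
  target order. A homogeneous \<open>f\<close> of the basis \<open>H\<close> is completed to the element \<open>f - f\<^sup>G\<close> of \<open>I\<close> by terms
  of lower weight, so the new elements form a minimal Groebner basis for \<open>after w'\<close>
  (\<open>crossing_marked_gb\<close>), which autoreduction makes reduced. When no candidate is left, all vectors
  of \<open>\<partial>(G)\<close> are positive for the target order, and \<open>G\<close> is the reduced basis for it (\<open>halt_correct\<close>).

  For termination, suppose that the walk goes on forever. Each vector changes sign at most once, so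
  the orders \<open>after w\<close> met on the way converge pointwise to a term order (\<open>term_order_limit\<close>). Its
  reduced Groebner basis \<open>K\<close> is finite, so its marks are correct for all late orders too, and
  by uniqueness the walk stays at \<open>K\<close>. It would cross infinitely many different vectors of the
  finite set \<open>\<partial>(K)\<close> (\<open>walk_terminates\<close>).
\<close>

abbreviation keys :: "('a \<Rightarrow>\<^sub>0 'b::zero) \<Rightarrow> 'a set" where "keys \<equiv> Poly_Mapping.keys"
abbreviation lookup :: "('a \<Rightarrow>\<^sub>0 'b::zero) \<Rightarrow> 'a \<Rightarrow> 'b" where "lookup \<equiv> Poly_Mapping.lookup"
abbreviation single :: "'a \<Rightarrow> 'b \<Rightarrow> ('a \<Rightarrow>\<^sub>0 'b::zero)" where "single \<equiv> Poly_Mapping.single"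

section \<open>Monomials and homogeneous parts\<close>

lemma lookup_single_mult:
  fixes g :: "('n, 'k::comm_ring_1) mpoly"
  shows "lookup (single b c * g) (b + v) = c * lookup g v"
  by (simp add: lookup_mult lookup_single when_mult)

lemma keys_single_mult:
  fixes g :: "('n, 'k::comm_ring_1) mpoly"
  shows "keys (single b c * g) \<subseteq> (+) b ` keys g"
  using keys_mult[of "single b c" g] by (auto split: if_splits)

lemma expo_dvd_refl [simp]: "expo_dvd u u"
  unfolding expo_dvd_def by (metis add.right_neutral)

lemma expo_dvd_trans: "expo_dvd u v \<Longrightarrow> expo_dvd v w \<Longrightarrow> expo_dvd u w"
  unfolding expo_dvd_def by (metis add.assoc)

lemma expo_dvd_add [simp]: "expo_dvd u (u + b)" "expo_dvd u (b + u)"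
  unfolding expo_dvd_def by (auto simp: add.commute)

lemma expo_dvd_iff: "expo_dvd u v \<longleftrightarrow> (\<forall>i. lookup u i \<le> lookup v i)"
proof
  assume "expo_dvd u v" then show "\<forall>i. lookup u i \<le> lookup v i"
    by (auto simp: expo_dvd_def lookup_add)
next
  assume "\<forall>i. lookup u i \<le> lookup v i"
  then have "v = u + (v - u)"
    by (intro poly_mapping_eqI) (simp add: lookup_add lookup_minus)
  then show "expo_dvd u v" unfolding expo_dvd_def by blast
qed

lemma expo_vec_add: "expo_vec (u + v) = expo_vec u + expo_vec v"
  by (simp add: expo_vec_def vec_eq_iff lookup_add)

lemma expo_vec_zero [simp]: "expo_vec 0 = 0"
  by (simp add: expo_vec_def vec_eq_iff)

lemma expo_vec_inject [simp]: "expo_vec u = (expo_vec v :: 'a::semiring_char_0 ^ 'n::finite) \<longleftrightarrow> u = v"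
  by (auto simp: expo_vec_def vec_eq_iff intro: poly_mapping_eqI)

definition restrict_keys :: "('a \<Rightarrow> bool) \<Rightarrow> ('a \<Rightarrow>\<^sub>0 'b::comm_monoid_add) \<Rightarrow> 'a \<Rightarrow>\<^sub>0 'b" where
  "restrict_keys P f = (\<Sum>a \<in> {a \<in> keys f. P a}. single a (lookup f a))"

lemma lookup_restrict_keys: "lookup (restrict_keys P f) a = (if P a then lookup f a else 0)"
proof -
  have "lookup (restrict_keys P f) a = (\<Sum>b \<in> {b \<in> keys f. P b}. if a = b then lookup f b else 0)"
    unfolding restrict_keys_def lookup_sum
    by (intro sum.cong) (auto simp: lookup_single when_def)
  also have "\<dots> = (if a \<in> {b \<in> keys f. P b} then lookup f a else 0)"
    by (subst sum.delta') auto
  finally show ?thesis by (auto simp: in_keys_iff)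
qed

lemma keys_restrict_keys: "keys (restrict_keys P f) = {a \<in> keys f. P a}"
  by (auto simp: in_keys_iff lookup_restrict_keys split: if_splits)

lemma restrict_keys_add: "restrict_keys P (f + g) = restrict_keys P f + restrict_keys P g"
  by (rule poly_mapping_eqI) (simp add: lookup_restrict_keys lookup_add)

lemma restrict_keys_zero [simp]: "restrict_keys P 0 = 0"
  by (rule poly_mapping_eqI) (simp add: lookup_restrict_keys)

lemma restrict_keys_diff:
  fixes f :: "_ \<Rightarrow>\<^sub>0 'b::ab_group_add"
  shows "restrict_keys P (f - g) = restrict_keys P f - restrict_keys P g"
  by (rule poly_mapping_eqI) (simp add: lookup_restrict_keys lookup_minus)

lemma restrict_keys_single_mult:
  fixes g :: "('n, 'k::comm_ring_1) mpoly"
  shows "restrict_keys P (single b c * g) = single b c * restrict_keys (\<lambda>v. P (b + v)) g"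
proof (rule poly_mapping_eqI)
  fix a
  show "lookup (restrict_keys P (single b c * g)) a
    = lookup (single b c * restrict_keys (\<lambda>v. P (b + v)) g) a"
  proof (cases "\<exists>v. a = b + v")
    case True
    then show ?thesis by (auto simp: lookup_restrict_keys lookup_single_mult)
  next
    case False
    then have "a \<notin> keys (single b c * g)"
      "a \<notin> keys (single b c * restrict_keys (\<lambda>v. P (b + v)) g)"
      using keys_single_mult by blast+
    then show ?thesis by (auto simp: lookup_restrict_keys in_keys_iff)
  qed
qed

text \<open>Every polynomial is a sum of monomials, so closure under multiplication by monomials
  suffices for an ideal.\<close>
lemma subspaceI_monomials:
  fixes S :: "('n, 'k::comm_ring_1) mpoly set"
  assumes "0 \<in> S" and add: "\<And>f g. f \<in> S \<Longrightarrow> g \<in> S \<Longrightarrow> f + g \<in> S"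
    and mult: "\<And>b c f. f \<in> S \<Longrightarrow> single b c * f \<in> S"
  shows "ideal.subspace S"
proof (rule ideal.subspaceI)
  fix p f :: "('n, 'k) mpoly" assume f: "f \<in> S"
  have "restrict_keys (\<lambda>_. True) p = p"
    by (rule poly_mapping_eqI) (simp add: lookup_restrict_keys)
  then have "(\<Sum>a \<in> keys p. single a (lookup p a)) = p" by (simp add: restrict_keys_def)
  then have "p * f = (\<Sum>a \<in> keys p. single a (lookup p a) * f)"
    by (metis sum_distrib_right)
  moreover have "(\<Sum>a \<in> A. single a (lookup p a) * f) \<in> S" if "finite A" for A
    using that by induction (auto simp: assms f)
  ultimately show "p * f \<in> S" by simp
qed (use assms in auto)

section \<open>Term orders on exponents\<close>

text \<open>A coordinate at a time, a sequence of exponents is thinned out to a subsequence that is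
  nondecreasing in that coordinate.\<close>
lemma expo_monotone_subsequence:
  fixes f :: "nat \<Rightarrow> 'n::finite expo"
  shows "\<exists>r. strict_mono (r::nat \<Rightarrow> nat) \<and> (\<forall>i\<in>S. \<forall>j k. j \<le> k \<longrightarrow> lookup (f (r j)) i \<le> lookup (f (r k)) i)"
proof (induction S rule: finite_induct[OF finite])
  case 1
  show ?case by (intro exI[of _ id]) (auto simp: strict_mono_def)
next
  case (2 i S)
  then obtain r :: "nat \<Rightarrow> nat" where r: "strict_mono r"
    "\<And>i j k. i \<in> S \<Longrightarrow> j \<le> k \<Longrightarrow> lookup (f (r j)) i \<le> lookup (f (r k)) i" by blast
  have "\<exists>q. strict_mono (q::nat \<Rightarrow> nat) \<and> (\<forall>j k. j \<le> k \<longrightarrow> h (q j) \<le> h (q k))" for h :: "nat \<Rightarrow> nat"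
  proof -
    obtain q :: "nat \<Rightarrow> nat" where q: "strict_mono q" "monoseq (\<lambda>n. h (q n))"
      using seq_monosub by blast
    show ?thesis
    proof (cases "\<forall>m n. m \<le> n \<longrightarrow> h (q m) \<le> h (q n)")
      case True
      with q(1) show ?thesis by blast
    next
      case False
      then have dec: "h (q n) \<le> h (q m)" if "m \<le> n" for m n
        using q(2) that unfolding monoseq_def by blast
      \<comment> \<open>A nonincreasing sequence of naturals is constant once it has reached its minimum.\<close>
      obtain N where N: "\<And>n. h (q N) \<le> h (q n)"
        using ex_has_least_nat[of "\<lambda>_. True" 0 "\<lambda>n. h (q n)"] by auto
      have "strict_mono (\<lambda>n. q (N + n))" using q(1) by (auto simp: strict_mono_def)
      moreover have "h (q (N + j)) \<le> h (q (N + k))" for j k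
        using dec[of N "N + j"] N[of "N + k"] by simp
      ultimately show ?thesis by (intro exI[of _ "\<lambda>n. q (N + n)"]) blast
    qed
  qed
  from this[of "\<lambda>n. lookup (f (r n)) i"] obtain q :: "nat \<Rightarrow> nat" where q: "strict_mono q"
    "\<And>j k. j \<le> k \<Longrightarrow> lookup (f (r (q j))) i \<le> lookup (f (r (q k))) i" by blast
  have "strict_mono (\<lambda>n. r (q n))" using r(1) q(1) by (auto simp: strict_mono_def)
  moreover have "lookup (f (r (q j))) i' \<le> lookup (f (r (q k))) i'" if "i' \<in> insert i S" "j \<le> k" for i' j k
    using that q r(2)[of i' "q j" "q k"] strict_mono_less_eq[OF q(1)] by auto
  ultimately show ?case by (intro exI[of _ "\<lambda>n. r (q n)"]) blast
qed

theorem dickson_sequence: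
  fixes f :: "nat \<Rightarrow> 'n::finite expo"
  shows "\<exists>i j. i < j \<and> expo_dvd (f i) (f j)"
proof -
  obtain r :: "nat \<Rightarrow> nat" where "strict_mono r" "\<And>i j k. j \<le> k \<Longrightarrow> lookup (f (r j)) i \<le> lookup (f (r k)) i"
    using expo_monotone_subsequence[of UNIV f] by blast
  then have "r 0 < r 1" "expo_dvd (f (r 0)) (f (r 1))"
    by (auto simp: strict_mono_def expo_dvd_iff)
  then show ?thesis by blast
qed

definition expo_less :: "(rat ^ 'n::finite \<Rightarrow> rat ^ 'n \<Rightarrow> bool) \<Rightarrow> 'n expo \<Rightarrow> 'n expo \<Rightarrow> bool" where
  "expo_less lt u v \<longleftrightarrow> lt (expo_vec u) (expo_vec v)"

locale monomial_order =
  fixes lt :: "rat ^ 'n::finite \<Rightarrow> rat ^ 'n \<Rightarrow> bool"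
  assumes term_order: "term_order lt"
begin

abbreviation less :: "'n expo \<Rightarrow> 'n expo \<Rightarrow> bool" (infix "\<sqsubset>" 50)
  where "u \<sqsubset> v \<equiv> expo_less lt u v"

lemma group_order: "group_order lt"
  using term_order by (simp add: term_order_def)

lemma less_irrefl [simp]: "\<not> u \<sqsubset> u"
  using group_order by (auto simp: expo_less_def group_order_def irreflp_def)

lemma less_trans: "u \<sqsubset> v \<Longrightarrow> v \<sqsubset> w \<Longrightarrow> u \<sqsubset> w"
  using group_order unfolding expo_less_def group_order_def by (meson transpD)

lemma less_linear: "u \<sqsubset> v \<or> u = v \<or> v \<sqsubset> u"
  using group_order unfolding expo_less_def group_order_def
  by (metis expo_vec_inject totalpD)

lemma less_asym: "u \<sqsubset> v \<Longrightarrow> \<not> v \<sqsubset> u"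
  using less_trans less_irrefl by blast

lemma less_add: "u \<sqsubset> v \<Longrightarrow> b + u \<sqsubset> b + v"
  using group_order unfolding expo_less_def group_order_def expo_vec_add by (metis add.commute)

lemma zero_less_vec:
  assumes "\<And>i. 0 \<le> x $ i" "x \<noteq> 0" "\<And>i. x $ i \<in> \<nat>"
  shows "lt 0 x"
proof -
  have lt_add: "lt (a + c) (b + d)" if "lt a b" "c = d \<or> lt c d" for a b c d
    using that group_order unfolding group_order_def by (metis add.commute transpD)
  have axis: "lt 0 (of_nat k *s axis i (1::rat)) \<or> k = 0" for k i
  proof (induction k)
    case (Suc k)
    have "lt 0 (axis i (1::rat))" using term_order by (simp add: term_order_def)
    from lt_add[OF this, of 0 "of_nat k *s axis i 1"] Suc show ?case
      by (auto simp: vector_space_over_itself.scale_left_distrib vec.scale_left_distrib)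
  qed simp
  have *: "lt 0 (\<Sum>i\<in>A. x $ i *s axis i 1) \<or> (\<Sum>i\<in>A. x $ i *s axis i 1) = 0" for A
  proof (induction A rule: infinite_finite_induct)
    case (insert i A)
    obtain k where k: "x $ i = of_nat k" using assms(3) by (meson Nats_cases)
    show ?case
    proof (cases "k = 0")
      case False
      then show ?thesis using lt_add[of 0 "x $ i *s axis i 1" 0 "\<Sum>i\<in>A. x $ i *s axis i 1"]
        insert axis[of k i] k by auto
    qed (use insert k in simp)
  qed auto
  have "x = (\<Sum>i\<in>UNIV. x $ i *s axis i 1)" by (simp add: basis_expansion)
  with *[of UNIV] assms(2) show ?thesis by simp
qed

lemma expo_dvd_less: "expo_dvd u v \<Longrightarrow> u = v \<or> u \<sqsubset> v"
proof -
  assume "expo_dvd u v"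
  then obtain b where b: "v = u + b" unfolding expo_dvd_def by blast
  have "0 \<sqsubset> b" if "b \<noteq> 0"
    unfolding expo_less_def expo_vec_zero
  proof (rule zero_less_vec)
    show "expo_vec b \<noteq> (0 :: rat ^ 'n)" using that expo_vec_inject[of b 0] by simp
  qed (auto simp: expo_vec_def)
  then show ?thesis using less_add[of 0 b u] b by (cases "b = 0") auto
qed

lemma expo_dvd_antisym: "expo_dvd (u :: 'n expo) v \<Longrightarrow> expo_dvd v u \<Longrightarrow> u = v"
  using expo_dvd_less less_asym by blast

lemma wfp_less: "wfp (\<sqsubset>)"
proof -
  have "\<nexists>f. \<forall>i. f (Suc i) \<sqsubset> f i"
  proof
    assume "\<exists>f. \<forall>i. f (Suc i) \<sqsubset> f i"
    then obtain f where f: "\<And>i::nat. f (Suc i) \<sqsubset> f i" by blast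
    have desc: "f j \<sqsubset> f i" if "i < j" for i j
      using that by (induction j) (use f less_trans less_Suc_eq in \<open>blast+\<close>)
    obtain i j where "i < j" "expo_dvd (f i) (f j)" using dickson_sequence by blast
    then show False using desc expo_dvd_less less_asym less_irrefl by metis
  qed
  then show ?thesis unfolding wfp_def wf_iff_no_infinite_down_chain by auto
qed

lemma finite_has_greatest:
  assumes "finite A" "A \<noteq> {}"
  shows "\<exists>m\<in>A. \<forall>a\<in>A - {m}. a \<sqsubset> m"
  using assms
proof (induction rule: finite_ne_induct)
  case (insert x F)
  then obtain m where "m \<in> F" "\<forall>a\<in>F - {m}. a \<sqsubset> m" by blast
  then show ?case using less_linear[of x m] less_trans by blast
qed simp

lemma lead_expo_eqI:
  assumes "u \<in> keys f" "\<And>v. v \<in> keys f \<Longrightarrow> v \<noteq> u \<Longrightarrow> v \<sqsubset> u"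
  shows "lead_expo lt f = u"
  unfolding lead_expo_def
proof (rule the_equality)
  fix v assume "v \<in> keys f \<and> (\<forall>w\<in>keys f - {v}. lt (expo_vec w) (expo_vec v))"
  then show "v = u" using assms less_asym[of u v] unfolding expo_less_def by blast
qed (use assms in \<open>auto simp: expo_less_def\<close>)

lemma lead_expo:
  assumes "f \<noteq> 0"
  shows lead_expo_in_keys: "lead_expo lt f \<in> keys f"
    and less_lead_expo: "v \<in> keys f \<Longrightarrow> v \<noteq> lead_expo lt f \<Longrightarrow> v \<sqsubset> lead_expo lt f"
proof -
  obtain m where m: "m \<in> keys f" "\<And>a. a \<in> keys f \<Longrightarrow> a \<noteq> m \<Longrightarrow> a \<sqsubset> m"
    using finite_has_greatest[of "keys f"] assms by auto
  then have "lead_expo lt f = m" by (intro lead_expo_eqI)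
  with m show "lead_expo lt f \<in> keys f"
    "v \<in> keys f \<Longrightarrow> v \<noteq> lead_expo lt f \<Longrightarrow> v \<sqsubset> lead_expo lt f" by auto
qed

text \<open>By Dickson's lemma the divisibility-minimal elements of a set form a finite antichain;
  they generate the set because divisors of an element are smaller in a well-order.\<close>
lemma finite_minimal_expos:
  fixes M :: "'n expo set"
  obtains F where "finite F" "F \<subseteq> M" "\<And>a. a \<in> M \<Longrightarrow> \<exists>u\<in>F. expo_dvd u a"
    "\<And>u v. u \<in> F \<Longrightarrow> v \<in> F \<Longrightarrow> expo_dvd u v \<Longrightarrow> u = v"
proof
  let ?F = "{a \<in> M. \<forall>b\<in>M. expo_dvd b a \<longrightarrow> b = a}"
  show "finite ?F"
  proof (rule ccontr)
    assume "infinite ?F"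
    from infinite_countable_subset[OF this] obtain f :: "nat \<Rightarrow> 'n expo"
      where f: "inj f" "range f \<subseteq> ?F" by auto
    obtain i j where "i < j" "expo_dvd (f i) (f j)" using dickson_sequence by blast
    moreover have "f i \<in> ?F" "f j \<in> ?F" using f(2) by auto
    ultimately have "f i = f j" by simp
    then show False using f(1) \<open>i < j\<close> by (simp add: inj_eq)
  qed
  show "\<exists>u\<in>?F. expo_dvd u a" if "a \<in> M" for a
    using that
  proof (induction a rule: wfp_induct_rule[OF wfp_less])
    case (1 a)
    show ?case
    proof (cases "a \<in> ?F")
      case False
      then obtain b where "b \<in> M" "expo_dvd b a" "b \<noteq> a" using 1 by blast
      with 1 expo_dvd_less show ?thesis by (meson expo_dvd_trans)
    qed auto
  qed
qed auto

end

section \<open>Division by marked polynomials\<close>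

definition well_marked ::
    "(rat ^ 'n::finite \<Rightarrow> rat ^ 'n \<Rightarrow> bool) \<Rightarrow> ('n, 'k::field) marked set \<Rightarrow> bool" where
  "well_marked lt G \<longleftrightarrow>
     (\<forall>(u, f)\<in>G. lookup f u = 1 \<and> (\<forall>v\<in>keys f - {u}. expo_less lt v u))"

lemma well_marked_subset: "well_marked lt G \<Longrightarrow> G' \<subseteq> G \<Longrightarrow> well_marked lt G'"
  unfolding well_marked_def by blast

lemma red_step_diff_in_ideal:
  assumes "ideal.subspace I" "\<And>u g. (u, g) \<in> G \<Longrightarrow> g \<in> I" "red_step G f f'"
  shows "f - f' \<in> I"
  using assms ideal.subspace_scale by (fastforce simp: red_step_def)

lemma red_steps_diff_in_ideal:
  assumes "(red_step G)\<^sup>*\<^sup>* f f'" "ideal.subspace I" "\<And>u g. (u, g) \<in> G \<Longrightarrow> g \<in> I"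
  shows "f - f' \<in> I"
  using assms(1)
proof induction
  case (step y z)
  then show ?case using ideal.subspace_add[OF assms(2), of "f - y" "y - z"]
    red_step_diff_in_ideal[OF assms(2,3)] by auto
qed (simp add: ideal.subspace_0 assms)

context monomial_order
begin

lemma keys_marked_multiple:
  fixes g :: "('n, 'k::field) mpoly"
  assumes "\<forall>v\<in>keys g - {u}. v \<sqsubset> u" "a \<in> keys (single b c * g)"
  shows "a = u + b \<or> a \<sqsubset> u + b"
proof -
  obtain v where "v \<in> keys g" "a = b + v" using keys_single_mult[of b c g] assms(2) by blast
  then show ?thesis using assms(1) less_add[of v u b] by (cases "v = u") (auto simp: add.commute)
qed

lemma red_stepE:
  assumes "red_step G f f'" "well_marked lt G"
  obtains u g b where "(u, g) \<in> G" "u + b \<in> keys f"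
    "f' = f - single b (lookup f (u + b)) * g" "lookup f' (u + b) = 0"
    "\<And>a. a \<noteq> u + b \<Longrightarrow> \<not> a \<sqsubset> u + b \<Longrightarrow> lookup f' a = lookup f a"
proof -
  obtain u g b where *: "(u, g) \<in> G" "u + b \<in> keys f"
    "f' = f - single b (lookup f (u + b) / lookup g u) * g"
    using assms(1) unfolding red_step_def by blast
  have g: "lookup g u = 1" "\<forall>v\<in>keys g - {u}. v \<sqsubset> u"
    using assms(2) *(1) unfolding well_marked_def by auto
  have f': "f' = f - single b (lookup f (u + b)) * g" using * g by simp
  have "lookup f' (u + b) = 0"
    using lookup_single_mult[of b "lookup f (u + b)" g u] g
    by (simp add: f' lookup_minus add.commute)
  moreover have "lookup f' a = lookup f a" if "a \<noteq> u + b" "\<not> a \<sqsubset> u + b" for a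
    using keys_marked_multiple[OF g(2)] that by (auto simp: f' lookup_minus in_keys_iff)
  ultimately show thesis using that * f' by blast
qed

text \<open>A reduction removes one exponent and can only introduce smaller ones, so the set of
  exponents descends in the multiset order.\<close>
lemma red_step_keys_mult:
  assumes "red_step G f f'" "well_marked lt G"
  shows "(mset_set (keys f'), mset_set (keys f)) \<in> mult {(u, v). u \<sqsubset> v}"
proof -
  obtain m where m: "m \<in> keys f" "lookup f' m = 0"
    "\<And>a. a \<noteq> m \<Longrightarrow> \<not> a \<sqsubset> m \<Longrightarrow> lookup f' a = lookup f a"
    using red_stepE[OF assms] by metis
  let ?above = "{a \<in> keys f. m \<sqsubset> a}"
  let ?low = "{a \<in> keys f. \<not> m \<sqsubset> a}" and ?low' = "{a \<in> keys f'. \<not> m \<sqsubset> a}"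
  have "lookup f' a = lookup f a" if "m \<sqsubset> a" for a
    using m(3)[of a] that less_asym[OF that] by auto
  then have "?above = {a \<in> keys f'. m \<sqsubset> a}" by (auto simp: in_keys_iff)
  then have 1: "mset_set (keys f') = mset_set ?above + mset_set ?low'"
    by (subst mset_set_Union[symmetric]) (auto intro: arg_cong[where f = mset_set])
  have 2: "mset_set (keys f) = mset_set ?above + mset_set ?low"
    by (subst mset_set_Union[symmetric]) (auto intro: arg_cong[where f = mset_set])
  have m_low: "m \<in># mset_set ?low" using m(1) by simp
  show ?thesis unfolding 1 2
  proof (rule one_step_implies_mult)
    show "mset_set ?low \<noteq> {#}" using m_low by (metis empty_iff set_mset_empty)
    have "(k, m) \<in> {(u, v). u \<sqsubset> v}" if "k \<in># mset_set ?low'" for k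
      using m(2) less_linear[of k m] that by (auto simp: in_keys_iff)
    then show "\<forall>k\<in>#mset_set ?low'. \<exists>j\<in>#mset_set ?low. (k, j) \<in> {(u, v). u \<sqsubset> v}"
      using m_low by blast
  qed
qed

lemma wf_mult_less: "wf (mult {(u, v). u \<sqsubset> v})"
  using wf_mult wfp_less unfolding wfp_def by blast

lemma wfp_red_step:
  assumes "well_marked lt G"
  shows "wfp (\<lambda>f' f. red_step G f f')"
  unfolding wfp_def
  by (rule wf_subset[OF wf_inv_image[OF wf_mult_less, of "\<lambda>f. mset_set (keys f)"]])
    (use red_step_keys_mult[OF _ assms] in \<open>auto simp: inv_image_def\<close>)

lemma remainder_exists:
  assumes "well_marked lt G"
  shows "\<exists>r. is_remainder G f r"
proof (induction f rule: wfp_induct_rule[OF wfp_red_step[OF assms]])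
  case (1 f)
  show ?case
  proof (cases "\<exists>(u, g)\<in>G. \<exists>a\<in>keys f. expo_dvd u a")
    case True
    then obtain u g b where "(u, g) \<in> G" "u + b \<in> keys f" unfolding expo_dvd_def by blast
    then obtain f' where "red_step G f f'" unfolding red_step_def by blast
    with 1[of f'] show ?thesis
      unfolding is_remainder_def by (meson converse_rtranclp_into_rtranclp)
  next
    case False
    then show ?thesis unfolding is_remainder_def by blast
  qed
qed

lemma red_steps_keys_bounded:
  assumes "(red_step G)\<^sup>*\<^sup>* f f'" "well_marked lt G" "\<And>a. a \<in> keys f \<Longrightarrow> a = m \<or> a \<sqsubset> m"
  shows "a \<in> keys f' \<Longrightarrow> a = m \<or> a \<sqsubset> m"
  using assms(1)
proof (induction arbitrary: a)
  case (step y z)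
  obtain c where c: "c \<in> keys y" "\<And>a. a \<noteq> c \<Longrightarrow> \<not> a \<sqsubset> c \<Longrightarrow> lookup z a = lookup y a"
    using red_stepE[OF step(2) assms(2)] by metis
  show ?case
  proof (cases "a \<in> keys y")
    case False
    then have "a = c \<or> a \<sqsubset> c" using step.prems c(2)[of a] by (cases "a = c \<or> a \<sqsubset> c") (auto simp: in_keys_iff)
    then show ?thesis using step.IH[OF c(1)] less_trans by auto
  qed (use step in auto)
qed (use assms in auto)

end

section \<open>Marked Groebner bases\<close>

text \<open>The covering condition says that every nonzero element of the ideal is reducible at some
  exponent, possibly not the leading one. In this form it does not mention the order, so a basis
  can be carried to every order that agrees with its marks; \<open>marked_gb_lead_divisible\<close> recovers
  the usual condition.\<close>
definition marked_gb ::
    "(rat ^ 'n::finite \<Rightarrow> rat ^ 'n \<Rightarrow> bool) \<Rightarrow> ('n, 'k::field) mpoly set \<Rightarrow>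
     ('n, 'k) marked set \<Rightarrow> bool" where
  "marked_gb lt I G \<longleftrightarrow> finite G \<and> snd ` G \<subseteq> I \<and> well_marked lt G \<and>
     (\<forall>f\<in>I. f \<noteq> 0 \<longrightarrow> (\<exists>(u, g)\<in>G. \<exists>a\<in>keys f. expo_dvd u a)) \<and>
     (\<forall>m\<in>G. \<forall>m'\<in>G. expo_dvd (fst m) (fst m') \<longrightarrow> m = m')"

lemma marked_gbD:
  assumes "marked_gb lt I G"
  shows marked_gb_finite: "finite G"
    and marked_gb_in_ideal: "(u, g) \<in> G \<Longrightarrow> g \<in> I"
    and marked_gb_well_marked: "well_marked lt G"
    and marked_gb_monic: "(u, g) \<in> G \<Longrightarrow> lookup g u = 1"
    and marked_gb_less: "(u, g) \<in> G \<Longrightarrow> v \<in> keys g \<Longrightarrow> v \<noteq> u \<Longrightarrow> expo_less lt v u"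
    and marked_gb_reducible:
      "f \<in> I \<Longrightarrow> f \<noteq> 0 \<Longrightarrow> \<exists>u g a. (u, g) \<in> G \<and> a \<in> keys f \<and> expo_dvd u a"
    and marked_gb_minimal:
      "(u, g) \<in> G \<Longrightarrow> (u', g') \<in> G \<Longrightarrow> expo_dvd u u' \<Longrightarrow> u = u' \<and> g = g'"
proof -
  note G = assms[unfolded marked_gb_def]
  show "finite G" using G by simp
  show "(u, g) \<in> G \<Longrightarrow> g \<in> I" using G imageI[of "(u, g)" G snd] by auto
  show wm: "well_marked lt G" using G by simp
  show "(u, g) \<in> G \<Longrightarrow> lookup g u = 1" using wm unfolding well_marked_def by fast
  show "(u, g) \<in> G \<Longrightarrow> v \<in> keys g \<Longrightarrow> v \<noteq> u \<Longrightarrow> expo_less lt v u"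
    using wm unfolding well_marked_def by fast
  show "f \<in> I \<Longrightarrow> f \<noteq> 0 \<Longrightarrow> \<exists>u g a. (u, g) \<in> G \<and> a \<in> keys f \<and> expo_dvd u a"
    using G by fast
  show "(u, g) \<in> G \<Longrightarrow> (u', g') \<in> G \<Longrightarrow> expo_dvd u u' \<Longrightarrow> u = u' \<and> g = g'"
    using bspec[OF bspec[OF G[THEN conjunct2, THEN conjunct2, THEN conjunct2, THEN conjunct2]],
        of "(u, g)" "(u', g')"] by simp
qed

lemma marked_gbI:
  assumes "finite G" and ideal: "\<And>u g. (u, g) \<in> G \<Longrightarrow> g \<in> I"
    and monic: "\<And>u g. (u, g) \<in> G \<Longrightarrow> lookup g u = 1"
    and less: "\<And>u g v. (u, g) \<in> G \<Longrightarrow> v \<in> keys g \<Longrightarrow> v \<noteq> u \<Longrightarrow> expo_less lt v u"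
    and reducible: "\<And>f. f \<in> I \<Longrightarrow> f \<noteq> 0 \<Longrightarrow> \<exists>u g a. (u, g) \<in> G \<and> a \<in> keys f \<and> expo_dvd u a"
    and minimal: "\<And>u g u' g'. (u, g) \<in> G \<Longrightarrow> (u', g') \<in> G \<Longrightarrow> expo_dvd u u' \<Longrightarrow> (u, g) = (u', g')"
  shows "marked_gb lt I G"
  unfolding marked_gb_def
proof (intro conjI ballI impI)
  show "snd ` G \<subseteq> I" using ideal by auto
  show "well_marked lt G" unfolding well_marked_def by (auto simp: monic intro: less)
  show "\<exists>(u, g)\<in>G. \<exists>a\<in>keys f. expo_dvd u a" if "f \<in> I" "f \<noteq> 0" for f
    using reducible[OF that] by fast
  show "m = m'" if "m \<in> G" "m' \<in> G" "expo_dvd (fst m) (fst m')" for m m'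
    using minimal[of "fst m" "snd m" "fst m'" "snd m'"] that by simp
qed fact

lemma autoreducedD:
  assumes "autoreduced G" "(u, g) \<in> G" "(u', f) \<in> G" "(u', f) \<noteq> (u, g)" "a \<in> keys f"
  shows "\<not> expo_dvd u a"
proof -
  have "\<forall>(u', f)\<in>G - {(u, g)}. \<forall>a\<in>keys f. \<not> expo_dvd u a"
    using bspec[OF assms(1)[unfolded autoreduced_def] assms(2)] by simp
  then show ?thesis using assms(3-5) by auto
qed

lemma autoreduction_step_exists:
  assumes "\<not> autoreduced G"
  shows "\<exists>G'. autoreduction_step G G'"
proof -
  obtain u g u' f b where *: "(u, g) \<in> G" "(u', f) \<in> G - {(u, g)}" "u + b \<in> keys f"
    using assms unfolding autoreduced_def expo_dvd_def by fast
  then have "(u, g) \<in> G - {(u', f)}" by auto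
  with *(3) obtain f' where "red_step (G - {(u', f)}) f f'" unfolding red_step_def by blast
  with *(2) show ?thesis unfolding autoreduction_step_def by blast
qed

lemma marked_gb_change_order:
  assumes "marked_gb lt I G" "\<And>u g v. (u, g) \<in> G \<Longrightarrow> v \<in> keys g \<Longrightarrow> v \<noteq> u \<Longrightarrow> expo_less lt' v u"
  shows "marked_gb lt' I G"
proof -
  have "well_marked lt' G"
    using assms(2) marked_gb_monic[OF assms(1)] unfolding well_marked_def by fast
  then show ?thesis using assms(1) unfolding marked_gb_def by simp
qed

context monomial_order
begin

text \<open>Were the leading exponent irreducible, it would survive every reduction, whereas elements
  of the ideal reduce to zero.\<close>
lemma marked_gb_lead_divisible:
  assumes I: "ideal.subspace I" and G: "marked_gb lt I G"
    and f: "f \<in> I" "m \<in> keys f" "\<And>a. a \<in> keys f \<Longrightarrow> a \<noteq> m \<Longrightarrow> a \<sqsubset> m"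
  shows "\<exists>u g. (u, g) \<in> G \<and> expo_dvd u m"
proof (rule ccontr)
  assume contra: "\<nexists>u g. (u, g) \<in> G \<and> expo_dvd u m"
  note wm = marked_gb_well_marked[OF G]
  from f show False
  proof (induction f rule: wfp_induct_rule[OF wfp_red_step[OF wm]])
    case (1 f)
    then have "f \<noteq> 0" by auto
    then obtain u g b where *: "(u, g) \<in> G" "u + b \<in> keys f"
      using marked_gb_reducible[OF G \<open>f \<in> I\<close>] unfolding expo_dvd_def by blast
    then obtain f' where red: "red_step G f f'" unfolding red_step_def by blast
    obtain u g b where *: "(u, g) \<in> G" "u + b \<in> keys f"
      "\<And>a. a \<noteq> u + b \<Longrightarrow> \<not> a \<sqsubset> u + b \<Longrightarrow> lookup f' a = lookup f a"
      using red_stepE[OF red wm] by metis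
    have "u + b \<noteq> m" using contra * by auto
    then have "u + b \<sqsubset> m" using 1 * by blast
    then have "lookup f' m = lookup f m" using * less_asym \<open>u + b \<noteq> m\<close> by metis
    then have "m \<in> keys f'" using 1 by (simp add: in_keys_iff)
    moreover have "f' \<in> I"
      using red_step_diff_in_ideal[OF I _ red] marked_gb_in_ideal[OF G] 1
        ideal.subspace_diff[OF I, of f "f - f'"] by fastforce
    moreover have "a \<sqsubset> m" if "a \<in> keys f'" "a \<noteq> m" for a
      using red_steps_keys_bounded[of G f f' m a] wm red 1 that by blast
    ultimately show False using "1.IH"[of f'] red by blast
  qed
qed

lemma marked_lead_expo:
  assumes "well_marked lt G" "(u, f) \<in> G"
  shows "lead_expo lt f = u" "f \<noteq> 0"
proof -
  have u: "u \<in> keys f" using assms by (auto simp: well_marked_def in_keys_iff)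
  then show "f \<noteq> 0" by auto
  show "lead_expo lt f = u" using assms u by (intro lead_expo_eqI) (auto simp: well_marked_def)
qed

lemma keys_span_initial_terms:
  fixes B :: "('n, 'k::field) mpoly set"
  assumes "p \<in> ideal.span (initial_term lt ` B)" "a \<in> keys p"
  shows "\<exists>g\<in>B. expo_dvd (lead_expo lt g) a"
proof -
  let ?S = "{p :: ('n, 'k) mpoly. \<forall>a\<in>keys p. \<exists>g\<in>B. expo_dvd (lead_expo lt g) a}"
  have "ideal.subspace ?S"
  proof (rule subspaceI_monomials)
    fix f g :: "('n, 'k) mpoly" assume "f \<in> ?S" "g \<in> ?S"
    then show "f + g \<in> ?S" using keys_add[of f g] by blast
  next
    fix b c and f :: "('n, 'k) mpoly" assume "f \<in> ?S"
    then show "single b c * f \<in> ?S"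
      using keys_single_mult[of b c f] expo_dvd_trans expo_dvd_add(2) by blast
  qed simp
  moreover have "initial_term lt g \<in> ?S" if "g \<in> B" for g
    using bexI[of "\<lambda>h. expo_dvd (lead_expo lt h) (lead_expo lt g)", OF expo_dvd_refl that]
    by (simp add: initial_term_def)
  ultimately have "ideal.span (initial_term lt ` B) \<subseteq> ?S" by (intro ideal.span_minimal) auto
  then show ?thesis using assms by blast
qed

theorem marked_reduced_iff:
  assumes I: "ideal.subspace I"
  shows "marked_reduced_groebner_basis lt I G \<longleftrightarrow> marked_gb lt I G \<and> autoreduced G"
proof
  assume "marked_reduced_groebner_basis lt I G"
  then obtain B where B: "reduced_groebner_basis lt I B"
    and G: "G = (\<lambda>f. (lead_expo lt f, f)) ` B"
    unfolding marked_reduced_groebner_basis_def by blast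
  have BI: "finite B" "B \<subseteq> I - {0}" "ideal.span (initial_term lt ` B) = initial_ideal lt I"
    and monic: "\<And>f. f \<in> B \<Longrightarrow> lookup f (lead_expo lt f) = 1"
    and red: "\<And>f g a. f \<in> B \<Longrightarrow> g \<in> B \<Longrightarrow> g \<noteq> f \<Longrightarrow> a \<in> keys f \<Longrightarrow> \<not> expo_dvd (lead_expo lt g) a"
    using B unfolding reduced_groebner_basis_def groebner_basis_def by auto
  have "\<exists>(u, g)\<in>G. \<exists>a\<in>keys f. expo_dvd u a" if f: "f \<in> I" "f \<noteq> 0" for f
  proof -
    have "initial_term lt f \<in> ideal.span (initial_term lt ` B)"
      unfolding BI(3) initial_ideal_def using f by (intro ideal.span_base) auto
    moreover have "lead_expo lt f \<in> keys (initial_term lt f)"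
      using lead_expo_in_keys[OF f(2)] by (simp add: initial_term_def in_keys_iff)
    ultimately show ?thesis
      using keys_span_initial_terms lead_expo_in_keys[OF f(2)] G by fastforce
  qed
  moreover have "f = g" if "f \<in> B" "g \<in> B" "expo_dvd (lead_expo lt f) (lead_expo lt g)" for f g
    using red[of g f "lead_expo lt g"] lead_expo_in_keys[of g] that BI(2) by auto
  moreover have "v \<sqsubset> lead_expo lt f" if "f \<in> B" "v \<in> keys f - {lead_expo lt f}" for f v
    using that less_lead_expo[of f v] BI(2) by auto
  ultimately have "marked_gb lt I G"
    unfolding marked_gb_def well_marked_def using BI(1,2) monic G by auto
  moreover have "autoreduced G" unfolding autoreduced_def G using red by auto
  ultimately show "marked_gb lt I G \<and> autoreduced G" by blast
next
  assume *: "marked_gb lt I G \<and> autoreduced G"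
  then have gb: "marked_gb lt I G" by blast
  note lead = marked_lead_expo[OF marked_gb_well_marked[OF gb]]
  let ?B = "snd ` G"
  have G: "G = (\<lambda>f. (lead_expo lt f, f)) ` ?B" using lead by force
  have sub: "?B \<subseteq> I - {0}" using lead marked_gb_in_ideal[OF gb] by force
  have "initial_term lt f \<in> ideal.span (initial_term lt ` ?B)" if f: "f \<in> I - {0}" for f
  proof -
    obtain u g b where g: "(u, g) \<in> G" "lead_expo lt f = u + b"
      using marked_gb_lead_divisible[OF I gb, of f "lead_expo lt f"] f lead_expo
      unfolding expo_dvd_def by blast
    then have "initial_term lt g = single u 1"
      using lead marked_gb_monic[OF gb] by (simp add: initial_term_def)
    then have "initial_term lt f = single b (lookup f (u + b)) * initial_term lt g"
      by (simp add: initial_term_def g mult_single add.commute)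
    moreover have "initial_term lt g \<in> initial_term lt ` ?B" using g by force
    ultimately show ?thesis by (simp add: ideal.span_base ideal.span_scale)
  qed
  then have "initial_ideal lt I \<subseteq> ideal.span (initial_term lt ` ?B)"
    unfolding initial_ideal_def by (intro ideal.span_minimal) (auto simp: ideal.subspace_span)
  moreover have "ideal.span (initial_term lt ` ?B) \<subseteq> initial_ideal lt I"
    unfolding initial_ideal_def using sub by (intro ideal.span_mono image_mono)
  ultimately have "groebner_basis lt I ?B"
    unfolding groebner_basis_def using marked_gb_finite[OF gb] sub by auto
  moreover have "\<forall>f\<in>?B. lookup f (lead_expo lt f) = 1"
    using lead marked_gb_monic[OF gb] by force
  moreover have "\<forall>f\<in>?B. \<forall>g\<in>?B - {f}. \<forall>a\<in>keys f. \<not> expo_dvd (lead_expo lt g) a"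
  proof (intro ballI)
    fix f g a assume f: "f \<in> ?B" and g: "g \<in> ?B - {f}" and a: "a \<in> keys f"
    obtain u v where "(u, f) \<in> G" "(v, g) \<in> G" using f g by auto
    then show "\<not> expo_dvd (lead_expo lt g) a"
      using autoreducedD[of G v g u f a] * g a lead(1)[of v g] by auto
  qed
  ultimately show "marked_reduced_groebner_basis lt I G"
    unfolding marked_reduced_groebner_basis_def reduced_groebner_basis_def using G by blast
qed

text \<open>For each minimal leading exponent \<open>u\<close>, the basis element marked at \<open>u\<close> is the monomial
  \<open>x\<^sup>u\<close> minus its remainder modulo arbitrary monic elements with the minimal leading exponents.\<close>
theorem marked_reduced_exists:
  assumes I: "ideal.subspace (I :: ('n, 'k::field) mpoly set)"
  shows "\<exists>G. marked_reduced_groebner_basis lt I G"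
proof -
  obtain F where F: "finite F" "F \<subseteq> lead_expo lt ` (I - {0})"
    "\<And>a. a \<in> lead_expo lt ` (I - {0}) \<Longrightarrow> \<exists>u\<in>F. expo_dvd u a"
    "\<And>u v. u \<in> F \<Longrightarrow> v \<in> F \<Longrightarrow> expo_dvd u v \<Longrightarrow> u = v"
    by (rule finite_minimal_expos[of "lead_expo lt ` (I - {0})"]) (rule that; assumption)
  have "\<forall>u\<in>F. \<exists>p. p \<in> I \<and> p \<noteq> 0 \<and> lead_expo lt p = u" using F(2) by blast
  then obtain p where p: "\<And>u. u \<in> F \<Longrightarrow> p u \<in> I \<and> p u \<noteq> 0 \<and> lead_expo lt (p u) = u"
    by metis
  define q where "q u = single 0 (inverse (lookup (p u) u)) * p u" for u
  have lookup_q: "lookup (q u) v = inverse (lookup (p u) u) * lookup (p u) v" for u v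
    unfolding q_def using lookup_single_mult[of 0 _ "p u" v] by simp
  let ?Q = "(\<lambda>u. (u, q u)) ` F"
  have "lookup (q u) u = 1" if "u \<in> F" for u
    using lead_expo_in_keys[of "p u"] p[OF that] by (auto simp: lookup_q in_keys_iff)
  moreover have "v \<sqsubset> u" if "u \<in> F" "v \<in> keys (q u)" "v \<noteq> u" for u v
    using less_lead_expo[of "p u" v] p[OF that(1)] that by (auto simp: lookup_q in_keys_iff)
  ultimately have wm: "well_marked lt ?Q" unfolding well_marked_def by auto
  have QI: "g \<in> I" if "(u, g) \<in> ?Q" for u g
    using that p ideal.subspace_scale[OF I] by (auto simp: q_def)
  define r where "r u = (SOME r. is_remainder ?Q (single u 1) r)" for u
  have r: "is_remainder ?Q (single u 1) (r u)" for u
    unfolding r_def by (rule someI_ex[OF remainder_exists[OF wm]])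
  have irred: "\<not> expo_dvd v a" if "v \<in> F" "a \<in> keys (r u)" for u v a
    using r[of u] that unfolding is_remainder_def by auto
  have r_less: "a \<sqsubset> u" if "u \<in> F" "a \<in> keys (r u)" for u a
  proof -
    have "a = u \<or> a \<sqsubset> u"
      using red_steps_keys_bounded[of ?Q "single u 1" "r u" u a] r[of u] that wm
      by (auto simp: is_remainder_def)
    then show ?thesis using irred[OF that] by auto
  qed
  let ?G = "(\<lambda>u. (u, single u 1 - r u)) ` F"
  have GI: "single u 1 - r u \<in> I" if "u \<in> F" for u
    by (rule red_steps_diff_in_ideal[OF _ I QI]) (use r[of u] in \<open>auto simp: is_remainder_def\<close>)
  have keysG: "v = u \<or> v \<in> keys (r u)" if "v \<in> keys (single u 1 - r u)" for u v
    using that by (auto simp: in_keys_iff lookup_minus lookup_single split: if_splits)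
  have "marked_gb lt I ?G"
  proof (rule marked_gbI)
    show "lookup g u = 1" if "(u, g) \<in> ?G" for u g
      using r_less[of u u] that
      by (cases "lookup (r u) u = 0") (auto simp: lookup_minus in_keys_iff)
    show "v \<sqsubset> u" if "(u, g) \<in> ?G" "v \<in> keys g" "v \<noteq> u" for u g v
      using that keysG[of v u] r_less[of u v] by auto
    show "\<exists>u g a. (u, g) \<in> ?G \<and> a \<in> keys f \<and> expo_dvd u a" if f: "f \<in> I" "f \<noteq> 0" for f
    proof -
      obtain u where "u \<in> F" "expo_dvd u (lead_expo lt f)" using F(3)[of "lead_expo lt f"] f by auto
      then show ?thesis using lead_expo_in_keys[OF f(2)] by blast
    qed
    show "(u, g) = (u', g')" if "(u, g) \<in> ?G" "(u', g') \<in> ?G" "expo_dvd u u'" for u g u' g'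
      using F(4)[of u u'] that by auto
  qed (use F(1) GI in auto)
  moreover have "autoreduced ?G"
  proof -
    have "\<not> expo_dvd v a" if "u \<in> F" "v \<in> F" "u \<noteq> v" "a \<in> keys (single u 1 - r u)" for u v a
      using keysG[OF that(4)] F(4)[of v u] irred[of v a u] that by auto
    then show ?thesis unfolding autoreduced_def by auto
  qed
  ultimately show ?thesis using marked_reduced_iff[OF I] by blast
qed

lemma autoreduced_irreducible:
  assumes "marked_gb lt I G" "autoreduced G" "(u, f) \<in> G" "a \<in> keys f" "a \<noteq> u" "(v, g) \<in> G"
  shows "\<not> expo_dvd v a"
proof (cases "(v, g) = (u, f)")
  case True
  then show ?thesis
    using expo_dvd_less[of v a] marked_gb_less[OF assms(1,3-5)] less_asym[of a u] assms(5) by auto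
next
  case False
  then show ?thesis using autoreducedD[OF assms(2,6,3) _ assms(4)] by auto
qed

text \<open>The marks are the divisibility-minimal leading exponents of the ideal.\<close>
lemma marks_unique:
  assumes I: "ideal.subspace I" and G: "marked_gb lt I G" "marked_gb lt I G'" "(u, f) \<in> G"
  shows "\<exists>f'. (u, f') \<in> G'"
proof -
  have lead: "\<exists>v g. (v, g) \<in> K' \<and> expo_dvd v w"
    if "marked_gb lt I K" "marked_gb lt I K'" "(w, h) \<in> K" for w h K K'
    using marked_gb_lead_divisible[OF I that(2), of h w] that marked_gb_less[OF that(1,3)]
      marked_gb_in_ideal[OF that(1,3)] marked_gb_monic[OF that(1,3)] by (auto simp: in_keys_iff)
  obtain u' f' where u': "(u', f') \<in> G'" "expo_dvd u' u" using lead[OF G] by blast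
  obtain u'' f'' where u'': "(u'', f'') \<in> G" "expo_dvd u'' u'" using lead[OF G(2,1) u'(1)] by blast
  have "u'' = u" using marked_gb_minimal[OF G(1) u''(1) G(3)] expo_dvd_trans u' u'' by blast
  then show ?thesis using u' u'' expo_dvd_antisym by blast
qed

theorem marked_reduced_unique:
  assumes I: "ideal.subspace I"
    and "marked_reduced_groebner_basis lt I G" "marked_reduced_groebner_basis lt I G'"
  shows "G = G'"
proof -
  have "K \<subseteq> K'" if K: "marked_gb lt I K" "autoreduced K" and K': "marked_gb lt I K'" "autoreduced K'"
    for K K'
  proof safe
    fix u f assume uf: "(u, f) \<in> K"
    then obtain f' where uf': "(u, f') \<in> K'" using marks_unique[OF I K(1) K'(1)] by blast
    have "f - f' = 0"
    proof (rule ccontr)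
      assume "f - f' \<noteq> 0"
      moreover have "f - f' \<in> I"
        using ideal.subspace_diff[OF I] uf uf' marked_gb_in_ideal K K' by blast
      ultimately obtain v g a where v: "(v, g) \<in> K" "a \<in> keys (f - f')" "expo_dvd v a"
        using marked_gb_reducible[OF K(1)] by blast
      obtain g' where g': "(v, g') \<in> K'" using marks_unique[OF I K(1) K'(1) v(1)] by blast
      have "a \<noteq> u" using v(2) marked_gb_monic[OF K(1) uf] marked_gb_monic[OF K'(1) uf']
        by (auto simp: in_keys_iff lookup_minus)
      moreover have "a \<in> keys f \<or> a \<in> keys f'" using v(2) by (auto simp: in_keys_iff lookup_minus)
      ultimately show False
        using autoreduced_irreducible[OF K uf _ _ v(1)] autoreduced_irreducible[OF K' uf' _ _ g'] v(3)
        by blast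
    qed
    then show "(u, f) \<in> K'" using uf' by simp
  qed
  then show ?thesis using assms marked_reduced_iff[OF I] by blast
qed

text \<open>The mark is never touched, since no other mark divides it.\<close>
lemma autoreduction_step_marked_gb:
  assumes I: "ideal.subspace I" and G: "marked_gb lt I G" and step: "autoreduction_step G G'"
  shows "marked_gb lt I G'"
proof -
  obtain u f f' where uf: "(u, f) \<in> G" and red: "(red_step (G - {(u, f)}))\<^sup>+\<^sup>+ f f'"
    and G': "G' = insert (u, f') (G - {(u, f)})"
    using step unfolding autoreduction_step_def by blast
  let ?R = "G - {(u, f)}"
  have wm: "well_marked lt ?R" using well_marked_subset[OF marked_gb_well_marked[OF G]] by blast
  have "f - f' \<in> I"
    using red_steps_diff_in_ideal[OF tranclp_into_rtranclp[OF red] I] marked_gb_in_ideal[OF G] by blast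
  then have f'I: "f' \<in> I"
    using ideal.subspace_diff[OF I marked_gb_in_ideal[OF G uf]] by fastforce
  have f_bound: "\<And>a. a \<in> keys f \<Longrightarrow> a = u \<or> a \<sqsubset> u" using marked_gb_less[OF G uf] by blast
  have bound: "a = u \<or> a \<sqsubset> u" if "(red_step ?R)\<^sup>*\<^sup>* f h" "a \<in> keys h" for h a
    using red_steps_keys_bounded[OF that(1) wm f_bound that(2)] .
  have "lookup h u = 1" if "(red_step ?R)\<^sup>*\<^sup>* f h" for h
    using that
  proof induction
    case base
    show ?case using marked_gb_monic[OF G uf] .
  next
    case (step y z)
    obtain v g b where *: "(v, g) \<in> ?R" "v + b \<in> keys y"
      "\<And>a. a \<noteq> v + b \<Longrightarrow> \<not> a \<sqsubset> v + b \<Longrightarrow> lookup z a = lookup y a"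
      using red_stepE[OF step(2) wm] by metis
    have "v + b \<noteq> u" using *(1) marked_gb_minimal[OF G _ uf, of v g] expo_dvd_add(1)[of v b] by auto
    then have "v + b \<sqsubset> u" using bound[OF step(1) *(2)] by blast
    then show ?case using *(3)[of u] step.IH \<open>v + b \<noteq> u\<close> less_asym by metis
  qed
  then have monic: "lookup f' u = 1" using red by (simp add: tranclp_into_rtranclp)
  have "finite G'" "snd ` G' \<subseteq> I"
    using G' f'I marked_gb_finite[OF G] marked_gb_in_ideal[OF G] by auto
  moreover have "well_marked lt G'"
    using wm monic bound[OF tranclp_into_rtranclp[OF red]] unfolding G' well_marked_def by auto
  moreover have "\<exists>(u, g)\<in>G'. \<exists>a\<in>keys h. expo_dvd u a" if "h \<in> I" "h \<noteq> 0" for h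
    using marked_gb_reducible[OF G that] unfolding G' by auto
  moreover have "m = m'" if "m \<in> G'" "m' \<in> G'" "expo_dvd (fst m) (fst m')" for m m'
  proof -
    note mm' = that
    have *: "\<exists>h. (fst k, h) \<in> G \<and> (k = (u, f') \<and> h = f \<or> k = (fst k, h) \<and> k \<noteq> (u, f))"
      if "k \<in> G'" for k using that uf unfolding G' by (cases k) auto
    obtain h h' where "(fst m, h) \<in> G" "m = (u, f') \<and> h = f \<or> m = (fst m, h) \<and> m \<noteq> (u, f)"
      "(fst m', h') \<in> G" "m' = (u, f') \<and> h' = f \<or> m' = (fst m', h') \<and> m' \<noteq> (u, f)"
      using *[OF mm'(1)] *[OF mm'(2)] by blast
    moreover from this mm'(3) have "fst m = fst m'" "h = h'"
      using marked_gb_minimal[OF G] by blast+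
    ultimately show ?thesis by (metis fst_conv)
  qed
  ultimately show ?thesis unfolding marked_gb_def by blast
qed

definition autoreduction_measure :: "(('n, 'k::field) marked set \<times> ('n, 'k) marked set) set" where
  "autoreduction_measure = inv_image
     (mult (inv_image (mult {(u, v). u \<sqsubset> v}) (\<lambda>m. mset_set (keys (snd m))))) mset_set"

lemma wf_autoreduction_measure: "wf autoreduction_measure"
  unfolding autoreduction_measure_def by (intro wf_inv_image wf_mult wf_mult_less)

lemma autoreduction_step_decreases:
  assumes G: "marked_gb lt I G" and step: "autoreduction_step G G'"
  shows "(G', G) \<in> autoreduction_measure"
proof -
  obtain u f f' where uf: "(u, f) \<in> G" and red: "(red_step (G - {(u, f)}))\<^sup>+\<^sup>+ f f'"
    and G': "G' = insert (u, f') (G - {(u, f)})"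
    using step unfolding autoreduction_step_def by blast
  let ?R = "G - {(u, f)}"
  have wm: "well_marked lt ?R" using well_marked_subset[OF marked_gb_well_marked[OF G]] by blast
  have "(mset_set (keys f'), mset_set (keys f)) \<in> mult {(u, v). u \<sqsubset> v}"
    using red
  proof induction
    case (step y z)
    have "trans {(u, v). u \<sqsubset> v}" using less_trans by (blast intro: transI)
    then show ?case by (rule transD[OF trans_mult red_step_keys_mult[OF step(2) wm] step.IH])
  qed (rule red_step_keys_mult[OF _ wm])
  moreover have "(u, f') \<notin> ?R" using marked_gb_minimal[OF G _ uf, of u f'] by auto
  moreover have "finite ?R" using marked_gb_finite[OF G] by simp
  moreover have "mset_set G = add_mset (u, f) (mset_set ?R)"
    using mset_set.insert[OF \<open>finite ?R\<close>, of "(u, f)"] uf by (simp add: insert_absorb)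
  ultimately show ?thesis
    using one_step_implies_mult[of "{#(u, f)#}" "{#(u, f')#}" _ "mset_set ?R"]
    unfolding autoreduction_measure_def G' by simp
qed

end

section \<open>Crossing a facet\<close>

text \<open>Here \<open>W\<close> is the weight on the facet. The orders on both sides refine it, and the order
  after the crossing breaks the ties of \<open>W\<close> like the target order.\<close>
locale facet_crossing =
  fixes before after target :: "rat ^ 'n::finite \<Rightarrow> rat ^ 'n \<Rightarrow> bool"
    and W :: "'n expo \<Rightarrow> 'r::linordered_ab_group_add"
    and I :: "('n, 'k::field) mpoly set"
    and G :: "('n, 'k) marked set"
  assumes before: "monomial_order before" and target: "monomial_order target"
    and W_add: "W (u + v) = W u + W v"
    and before_W: "W u < W v \<Longrightarrow> expo_less before u v"
    and after_W: "W u < W v \<Longrightarrow> expo_less after u v"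
    and after_target: "W u = W v \<Longrightarrow> expo_less target u v \<Longrightarrow> expo_less after u v"
    and I: "ideal.subspace I"
    and G: "marked_gb before I G"
begin

abbreviation part :: "'r \<Rightarrow> ('n, 'k) mpoly \<Rightarrow> ('n, 'k) mpoly" where
  "part d \<equiv> restrict_keys (\<lambda>v. W v = d)"

definition form :: "('n, 'k) marked \<Rightarrow> ('n, 'k) mpoly" where
  "form m = part (W (fst m)) (snd m)"

definition J :: "('n, 'k) mpoly set" where
  "J = ideal.span (form ` G)"

lemma J_subspace: "ideal.subspace J"
  unfolding J_def by (rule ideal.subspace_span)

lemma W_le_mark:
  assumes "(u, g) \<in> G" "v \<in> keys g"
  shows "W v \<le> W u"
proof (rule ccontr)
  assume "\<not> W v \<le> W u"
  then have "expo_less before u v" "v \<noteq> u" using before_W by auto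
  then show False
    using marked_gb_less[OF G assms] monomial_order.less_asym[OF before] by blast
qed

lemma part_single_mult: "part d (single b c * f) = single b c * part (d - W b) f"
proof -
  have "(\<lambda>v. W (b + v) = d) = (\<lambda>v. W v = d - W b)" by (auto simp: W_add fun_eq_iff algebra_simps)
  then show ?thesis by (simp add: restrict_keys_single_mult)
qed

lemma part_eq_0: "(\<And>a. a \<in> keys f \<Longrightarrow> W a \<noteq> d) \<Longrightarrow> part d f = 0"
  by (rule poly_mapping_eqI) (auto simp: lookup_restrict_keys in_keys_iff)

lemma part_form: "part d (form m) = (if d = W (fst m) then form m else 0)"
  by (rule poly_mapping_eqI) (auto simp: lookup_restrict_keys form_def)

text \<open>Every reduction of \<open>f\<close> changes its part of top weight by a multiple of one of the forms
  that generate \<open>J\<close>, and \<open>f\<close> reduces to zero.\<close>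
lemma top_part_in_J:
  assumes "f \<in> I" "\<And>a. a \<in> keys f \<Longrightarrow> W a \<le> d"
  shows "part d f \<in> J"
  using assms
proof (induction f rule: wfp_induct_rule[OF monomial_order.wfp_red_step[OF before marked_gb_well_marked[OF G]]])
  case (1 f)
  show ?case
  proof (cases "f = 0")
    case True
    then show ?thesis by (simp add: ideal.subspace_0[OF J_subspace])
  next
    case False
    then obtain f' where red: "red_step G f f'"
      using marked_gb_reducible[OF G 1(2)] unfolding red_step_def expo_dvd_def by blast
    obtain u g b where *: "(u, g) \<in> G" "u + b \<in> keys f"
      and f': "f' = f - single b (lookup f (u + b)) * g"
      using monomial_order.red_stepE[OF before red marked_gb_well_marked[OF G]] by metis
    let ?m = "single b (lookup f (u + b))"
    have ub: "W u \<le> d - W b" using 1(3)[OF *(2)] by (simp add: W_add algebra_simps)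
    have keys_m: "W a \<le> d" if "a \<in> keys (?m * g)" for a
    proof -
      obtain v where "v \<in> keys g" "a = b + v" using keys_single_mult[of b _ g] \<open>a \<in> keys (?m * g)\<close> by blast
      moreover from this have "W v \<le> d - W b" using W_le_mark[OF *(1)] ub by fastforce
      ultimately show ?thesis by (simp add: W_add algebra_simps)
    qed
    have "W a \<le> d" if "a \<in> keys f'" for a
      using keys_m[of a] 1(3)[of a] that unfolding f' by (cases "a \<in> keys f") (auto simp: in_keys_iff lookup_minus)
    moreover have "f' \<in> I"
      unfolding f' using ideal.subspace_diff[OF I 1(2)] ideal.subspace_scale[OF I] marked_gb_in_ideal[OF G *(1)]
      by blast
    ultimately have "part d f' \<in> J" using "1.IH" red by blast
    moreover have "part d (?m * g) \<in> J"
    proof (cases "W u = d - W b")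
      case True
      then have "part d (?m * g) = ?m * form (u, g)" by (simp add: part_single_mult form_def)
      moreover have "form (u, g) \<in> J" unfolding J_def using *(1) by (intro ideal.span_base imageI)
      ultimately show ?thesis using ideal.subspace_scale[OF J_subspace] by simp
    next
      case False
      then have "part (d - W b) g = 0" using W_le_mark[OF *(1)] ub by (intro part_eq_0) fastforce
      then show ?thesis by (simp add: part_single_mult ideal.subspace_0[OF J_subspace])
    qed
    ultimately have "part d f' + part d (?m * g) \<in> J" by (rule ideal.subspace_add[OF J_subspace])
    then show ?thesis by (simp add: f' restrict_keys_diff)
  qed
qed

lemma J_homogeneous:
  assumes "h \<in> J"
  shows "part d h \<in> J"
proof -
  let ?S = "{h. \<forall>d. part d h \<in> J}"
  have "ideal.subspace ?S"
  proof (rule subspaceI_monomials)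
    show "f + g \<in> ?S" if "f \<in> ?S" "g \<in> ?S" for f g
      using that ideal.subspace_add[OF J_subspace] by (simp add: restrict_keys_add)
    show "single b c * f \<in> ?S" if "f \<in> ?S" for b c f
      using that ideal.subspace_scale[OF J_subspace] by (simp add: part_single_mult)
  qed (simp add: ideal.subspace_0[OF J_subspace])
  moreover have "form ` G \<subseteq> ?S"
    using ideal.span_base[of _ "form ` G"] ideal.subspace_0[OF J_subspace]
    by (auto simp: part_form J_def)
  ultimately have "J \<subseteq> ?S" unfolding J_def by (intro ideal.span_minimal)
  then show ?thesis using assms by blast
qed

text \<open>The converse of \<open>top_part_in_J\<close>: a homogeneous element of \<open>J\<close> is the part of top weight of an
  element of \<open>I\<close>, since this holds for the generators and passes to sums and monomial multiples.\<close>
lemma J_lift: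
  assumes "h \<in> J"
  shows "\<exists>f\<in>I. \<forall>a\<in>keys (f - part d h). W a < d"
proof -
  let ?S = "{h. \<forall>d. \<exists>f\<in>I. \<forall>a\<in>keys (f - part d h). W a < d}"
  have "ideal.subspace ?S"
  proof (rule subspaceI_monomials)
    show "0 \<in> ?S" using ideal.subspace_0[OF I] by (auto intro!: bexI[of _ 0])
    show "h + h' \<in> ?S" if "h \<in> ?S" "h' \<in> ?S" for h h'
    proof (intro CollectI allI)
      fix d
      obtain f f' where f: "f \<in> I" "\<forall>a\<in>keys (f - part d h). W a < d"
        "f' \<in> I" "\<forall>a\<in>keys (f' - part d h'). W a < d" using \<open>h \<in> ?S\<close> \<open>h' \<in> ?S\<close> by blast
      have eq: "(f + f') - part d (h + h') = (f - part d h) + (f' - part d h')"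
        by (simp add: restrict_keys_add)
      have "keys ((f + f') - part d (h + h')) \<subseteq> keys (f - part d h) \<union> keys (f' - part d h')"
        unfolding eq by (rule keys_add)
      moreover have "f + f' \<in> I" using ideal.subspace_add[OF I] f by blast
      ultimately show "\<exists>f\<in>I. \<forall>a\<in>keys (f - part d (h + h')). W a < d" using f by blast
    qed
    show "single b c * h \<in> ?S" if "h \<in> ?S" for b c h
    proof (intro CollectI allI)
      fix d
      obtain f where f: "f \<in> I" "\<forall>a\<in>keys (f - part (d - W b) h). W a < d - W b"
        using \<open>h \<in> ?S\<close> by blast
      have "single b c * f - part d (single b c * h) = single b c * (f - part (d - W b) h)"
        unfolding part_single_mult by (rule right_diff_distrib[symmetric])
      then have "W a < d" if "a \<in> keys (single b c * f - part d (single b c * h))" for a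
        using keys_single_mult[of b c "f - part (d - W b) h"] that f(2)
        by (auto simp: W_add algebra_simps)
      moreover have "single b c * f \<in> I" using ideal.subspace_scale[OF I f(1)] .
      ultimately show "\<exists>f\<in>I. \<forall>a\<in>keys (f - part d (single b c * h)). W a < d" by blast
    qed
  qed
  moreover have "form m \<in> ?S" if "m \<in> G" for m
  proof (intro CollectI allI)
    fix d
    have m: "(fst m, snd m) \<in> G" using that by simp
    show "\<exists>f\<in>I. \<forall>a\<in>keys (f - part d (form m)). W a < d"
    proof (cases "d = W (fst m)")
      case True
      have "W a < d" if "a \<in> keys (snd m - form m)" for a
      proof -
        have "a \<in> keys (snd m)" "W a \<noteq> d"
          using that True by (auto simp: form_def in_keys_iff lookup_minus lookup_restrict_keys split: if_splits)
        then show ?thesis using W_le_mark[OF m] True by fastforce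
      qed
      then show ?thesis using True marked_gb_in_ideal[OF G m] by (auto simp: part_form)
    next
      case False
      then show ?thesis using ideal.subspace_0[OF I] by (auto simp: part_form intro!: bexI[of _ 0])
    qed
  qed
  ultimately have "J \<subseteq> ?S" unfolding J_def by (intro ideal.span_minimal) auto
  then show ?thesis using assms by blast
qed

text \<open>Otherwise the part of \<open>f\<close> outside the weight of its mark would be a nonzero element
  of \<open>J\<close> whose exponents are irreducible modulo \<open>H\<close>.\<close>
lemma reduced_basis_homogeneous:
  assumes H: "marked_gb target J H" "autoreduced H" and f: "(u, f) \<in> H" "a \<in> keys f"
  shows "W a = W u"
proof (rule ccontr)
  assume "W a \<noteq> W u"
  let ?p = "f - part (W u) f"
  have keys_p: "keys ?p = {a \<in> keys f. W a \<noteq> W u}"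
    by (auto simp: in_keys_iff lookup_minus lookup_restrict_keys split: if_splits)
  have "f \<in> J" using marked_gb_in_ideal[OF H(1) f(1)] .
  then have "?p \<in> J" using ideal.subspace_diff[OF J_subspace] J_homogeneous by blast
  moreover have "?p \<noteq> 0" using keys_p f(2) \<open>W a \<noteq> W u\<close> by fastforce
  ultimately obtain v g c where "(v, g) \<in> H" "c \<in> keys ?p" "expo_dvd v c"
    using marked_gb_reducible[OF H(1)] by blast
  then show False
    using monomial_order.autoreduced_irreducible[OF target H f(1), of c v g] keys_p by auto
qed

text \<open>A remainder of a homogeneous element of \<open>J\<close> drops in weight: a part of top weight would
  be the top part of an element of the ideal, hence reducible.\<close>
lemma remainder_of_reduced_basis:
  assumes H: "marked_gb target J H" "autoreduced H" and f: "(u, f) \<in> H" and r: "is_remainder G f r"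
  shows "f - r \<in> I" and "a \<in> keys r \<Longrightarrow> W a < W u"
proof -
  note wm = marked_gb_well_marked[OF G]
  have steps: "(red_step G)\<^sup>*\<^sup>* f r" using r by (simp add: is_remainder_def)
  show fr: "f - r \<in> I"
    using red_steps_diff_in_ideal[OF steps I] marked_gb_in_ideal[OF G] by blast
  have homog: "W a = W u" if "a \<in> keys f" for a using reduced_basis_homogeneous[OF H f that] .
  have r_le: "W a \<le> W u" if "a \<in> keys r" for a
    using steps that
  proof (induction arbitrary: a)
    case (step y z)
    obtain v g b where *: "(v, g) \<in> G" "v + b \<in> keys y" "z = y - single b (lookup y (v + b)) * g"
      using monomial_order.red_stepE[OF before step(2) wm] by metis
    show ?case
    proof (cases "a \<in> keys y")
      case False
      then have "a \<in> keys (single b (lookup y (v + b)) * g)"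
        using step.prems *(3) by (auto simp: in_keys_iff lookup_minus)
      then obtain c where "c \<in> keys g" "a = b + c" using keys_single_mult[of b _ g] by blast
      moreover from this have "W c \<le> W v" using W_le_mark[OF *(1)] by blast
      ultimately show ?thesis using step.IH[OF *(2)] by (simp add: W_add add.commute) (meson add_left_mono order_trans)
    qed (use step in auto)
  qed (use homog in auto)
  have part_f: "part (W u) f = f"
    by (rule poly_mapping_eqI) (use homog in \<open>auto simp: lookup_restrict_keys in_keys_iff\<close>)
  obtain F where F: "F \<in> I" "\<And>a. a \<in> keys (F - f) \<Longrightarrow> W a < W u"
    using J_lift[OF marked_gb_in_ideal[OF H(1) f], of "W u"] unfolding part_f by blast
  let ?q = "F - f + r"
  show "W a < W u" if a: "a \<in> keys r"
  proof (rule ccontr)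
    assume "\<not> W a < W u"
    then have Wa: "W a = W u" using r_le[OF a] by simp
    then have "lookup (F - f) a = 0" using F(2)[of a] by (auto simp: in_keys_iff)
    then have aq: "a \<in> keys ?q" using a by (auto simp: in_keys_iff lookup_add)
    have q: "?q = F - (f - r)" by simp
    have "?q \<in> I" unfolding q by (rule ideal.subspace_diff[OF I F(1) fr])
    have "?q \<noteq> 0" using aq by auto
    define m where "m = lead_expo before ?q"
    have m: "m \<in> keys ?q" "\<And>v. v \<in> keys ?q \<Longrightarrow> v \<noteq> m \<Longrightarrow> expo_less before v m"
      unfolding m_def using monomial_order.lead_expo[OF before \<open>?q \<noteq> 0\<close>] by blast+
    have "\<not> W m < W a"
      using before_W[of m a] m(2)[OF aq] monomial_order.less_asym[OF before, of m a] by auto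
    then have "m \<notin> keys (F - f)" using F(2)[of m] Wa by auto
    then have "m \<in> keys r" using m(1) by (auto simp: in_keys_iff lookup_add)
    moreover obtain v g where "(v, g) \<in> G" "expo_dvd v m"
      using monomial_order.marked_gb_lead_divisible[OF before I G \<open>?q \<in> I\<close> m] by blast
    ultimately show False using r unfolding is_remainder_def by blast
  qed
qed

text \<open>Only terms of lower weight are subtracted from \<open>f\<close>, so its mark becomes the leading exponent
  for the new order. The marks cover the ideal, because the part of top weight of an element of
  \<open>I\<close> lies in \<open>J\<close> and is therefore reducible modulo \<open>H\<close>.\<close>
theorem crossing_marked_gb:
  assumes H: "marked_gb target J H" "autoreduced H"
    and rem: "\<And>u f. (u, f) \<in> H \<Longrightarrow> is_remainder G f (rem f)"
  shows "marked_gb after I ((\<lambda>(u, f). (u, f - rem f)) ` H)"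
proof (rule marked_gbI)
  let ?H' = "(\<lambda>(u, f). (u, f - rem f)) ` H"
  note r = remainder_of_reduced_basis[OF H _ rem]
  show "finite ?H'" using marked_gb_finite[OF H(1)] by simp
  show "g \<in> I" if "(u, g) \<in> ?H'" for u g using that r(1) by auto
  show "lookup g u = 1" if "(u, g) \<in> ?H'" for u g
  proof -
    obtain f where f: "(u, f) \<in> H" "g = f - rem f" using \<open>(u, g) \<in> ?H'\<close> by auto
    have "lookup (rem f) u = 0" using r(2)[OF f(1) f(1), of u] by (auto simp: in_keys_iff)
    then show ?thesis using marked_gb_monic[OF H(1) f(1)] f(2) by (simp add: lookup_minus)
  qed
  show "expo_less after v u" if "(u, g) \<in> ?H'" "v \<in> keys g" "v \<noteq> u" for u g v
  proof -
    obtain f where f: "(u, f) \<in> H" "g = f - rem f" using \<open>(u, g) \<in> ?H'\<close> by auto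
    show ?thesis
    proof (cases "v \<in> keys (rem f)")
      case True
      then show ?thesis using r(2)[OF f(1) f(1)] after_W by blast
    next
      case False
      then have "v \<in> keys f" using that(2) f(2) by (auto simp: in_keys_iff lookup_minus)
      then show ?thesis
        using after_target reduced_basis_homogeneous[OF H f(1)] marked_gb_less[OF H(1) f(1)] that(3) by blast
    qed
  qed
  show "\<exists>u g a. (u, g) \<in> ?H' \<and> a \<in> keys f \<and> expo_dvd u a" if f: "f \<in> I" "f \<noteq> 0" for f
  proof -
    define d where "d = Max (W ` keys f)"
    have le: "W a \<le> d" if "a \<in> keys f" for a unfolding d_def using that by simp
    have "d \<in> W ` keys f" unfolding d_def using f(2) by (intro Max_in) auto
    then obtain a where "a \<in> keys f" "W a = d" by auto
    then have "part d f \<noteq> 0" using keys_restrict_keys[of "\<lambda>v. W v = d" f] by fastforce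
    then obtain u g c where "(u, g) \<in> H" "c \<in> keys (part d f)" "expo_dvd u c"
      using marked_gb_reducible[OF H(1) top_part_in_J[OF f(1) le]] by blast
    then show ?thesis by (force simp: keys_restrict_keys)
  qed
  show "(u, g) = (u', g')" if "(u, g) \<in> ?H'" "(u', g') \<in> ?H'" "expo_dvd u u'" for u g u' g'
  proof -
    obtain f f' where "(u, f) \<in> H" "g = f - rem f" "(u', f') \<in> H" "g' = f' - rem f'"
      using \<open>(u, g) \<in> ?H'\<close> \<open>(u', g') \<in> ?H'\<close> by auto
    then show ?thesis using marked_gb_minimal[OF H(1) _ _ that(3)] by auto
  qed
qed

end

section \<open>Lexicographic comparison as comparison of polynomials\<close>

text \<open>Polynomials are ordered by their leading coefficients, that is, with the indeterminate
  infinitely large, so a list compares lexicographically like the polynomial whose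
  coefficients, from the top down, are its entries.\<close>
primrec lex_poly :: "'a::comm_ring_1 list \<Rightarrow> 'a poly" where
  "lex_poly [] = 0"
| "lex_poly (c # cs) = monom c (length cs) + lex_poly cs"

lemma coeff_lex_poly_eq_0: "length cs \<le> k \<Longrightarrow> coeff (lex_poly cs) k = 0"
  by (induction cs) auto

lemma lex_poly_eq_0:
  assumes "lex_poly cs = 0" "c \<in> set cs"
  shows "c = 0"
  using assms
proof (induction cs)
  case (Cons b cs)
  have "coeff (lex_poly (b # cs)) (length cs) = b" by (simp add: coeff_lex_poly_eq_0)
  with Cons show ?case by auto
qed simp

lemma lex_poly_add: "lex_poly (map (\<lambda>p. f p + g p) ps) = lex_poly (map f ps) + lex_poly (map g ps)"
  by (induction ps) (auto simp: add_monom[symmetric] algebra_simps)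

lemma lex_poly_mult: "lex_poly (map (\<lambda>p. c * f p) ps) = [:c:] * lex_poly (map f ps)"
  by (induction ps) (auto simp: smult_monom algebra_simps smult_add_right)

lemma pos_monom_add:
  fixes p :: "'a::linordered_idom poly"
  assumes "\<And>k. n \<le> k \<Longrightarrow> coeff p k = 0"
  shows "0 < monom c n + p \<longleftrightarrow> 0 < c \<or> c = 0 \<and> 0 < p"
proof (cases "c = 0")
  case False
  have "degree (monom c n + p) = n"
  proof (rule antisym)
    show "degree (monom c n + p) \<le> n" using assms by (intro degree_le) auto
    show "n \<le> degree (monom c n + p)" using False assms by (intro le_degree) simp
  qed
  then show ?thesis using False assms by (simp add: less_poly_def pos_poly_def)
qed simp

lemma lexord_iff_lex_poly:
  fixes xs ys :: "'a::linordered_idom list"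
  assumes "length xs = length ys"
  shows "(xs, ys) \<in> lexord {(a, b). a < b} \<longleftrightarrow> lex_poly xs < lex_poly ys"
  using assms
proof (induction rule: list_induct2)
  case (Cons x xs y ys)
  have "lex_poly (x # xs) < lex_poly (y # ys)
    \<longleftrightarrow> 0 < monom (y - x) (length ys) + (lex_poly ys - lex_poly xs)"
    using Cons.hyps by (subst diff_gt_0_iff_gt[symmetric]) (simp add: diff_monom[symmetric] algebra_simps)
  also have "\<dots> \<longleftrightarrow> x < y \<or> x = y \<and> lex_poly xs < lex_poly ys"
    using Cons.hyps by (subst pos_monom_add) (auto simp: coeff_lex_poly_eq_0)
  finally show ?case using Cons.IH by auto
qed simp

lemma lexord_map:
  assumes "length xs = length ys" "inj f" "\<And>x y. r x y \<longleftrightarrow> s (f x) (f y)"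
  shows "(xs, ys) \<in> lexord {(x, y). r x y} \<longleftrightarrow> (map f xs, map f ys) \<in> lexord {(x, y). s x y}"
  using assms(1)
proof (induction rule: list_induct2)
  case (Cons x xs y ys)
  then show ?case using assms(2,3) by (auto simp: inj_eq)
qed simp

lemma pairing_add: "pairing p (u + v) = pairing p u + pairing p v"
  by (simp add: pairing_def sum.distrib algebra_simps)

lemma pairing_scale: "pairing p (c *s v) = c * pairing p v"
  unfolding pairing_def by (subst sum_distrib_left, rule sum.cong[OF refl]) (simp only: vector_smult_component mult.left_commute)

lemma pairing_zero_imp_zero:
  fixes v :: "'a::linordered_field ^ 'n::finite"
  assumes "vec.span S = UNIV" "\<And>p. p \<in> S \<Longrightarrow> pairing p v = 0"
  shows "v = 0"
proof -
  have "pairing (p + q) v = pairing p v + pairing q v" for p q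
    by (simp add: pairing_def of_rat_add distrib_right sum.distrib)
  moreover have "pairing (c *s p) v = of_rat c * pairing p v" for c p
    unfolding pairing_def
    by (subst sum_distrib_left, rule sum.cong[OF refl]) (simp only: vector_smult_component of_rat_mult)
  moreover have "pairing 0 v = 0" by (simp add: pairing_def)
  ultimately have "vec.subspace {p. pairing p v = 0}" by (simp add: vec.subspace_def)
  then have "vec.span S \<subseteq> {p. pairing p v = 0}" using assms(2) by (intro vec.span_minimal) auto
  then have "pairing (axis j 1) v = 0" for j using assms(1) by auto
  moreover have "pairing (axis j 1) v = v $ j" for j
  proof -
    have "pairing (axis j 1) v = (\<Sum>i\<in>UNIV. if i = j then v $ i else 0)"
      unfolding pairing_def by (rule sum.cong) (auto simp: axis_def)
    then show ?thesis by simp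
  qed
  ultimately have "v $ j = 0" for j by simp
  then show ?thesis by (simp add: vec_eq_iff)
qed

section \<open>The two orders as polynomial-valued functionals\<close>

text \<open>With infinitely large indeterminates \<open>X\<close> and \<open>Y\<close>, \<open>Y\<close> dominating every power
  of \<open>X\<close>, the source order is given by the functional \<open>\<Sum>\<^sub>i \<langle>\<omega>\<^sub>i, v\<rangle> X\<^sup>n\<^sup>-\<^sup>i\<close> and the target order by
  \<open>\<Sum>\<^sub>i \<langle>\<tau>\<^sub>i, v\<rangle> Y\<^sup>n\<^sup>-\<^sup>i\<close>: the two ends of a generic segment of weight vectors.\<close>
definition lex_val :: "(rat ^ 'n::finite) list \<Rightarrow> real ^ 'n \<Rightarrow> real poly" where
  "lex_val ps v = lex_poly (map (\<lambda>p. pairing p v) ps)"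

definition src :: "(rat ^ 'n::finite) list \<Rightarrow> real ^ 'n \<Rightarrow> real poly poly" where
  "src \<omega> v = [:lex_val \<omega> v:]"

definition tgt :: "(rat ^ 'n::finite) list \<Rightarrow> real ^ 'n \<Rightarrow> real poly poly" where
  "tgt \<tau> v = lex_poly (map (\<lambda>p. [:pairing p v:]) \<tau>)"

definition real_vec :: "rat ^ 'n::finite \<Rightarrow> real ^ 'n" where
  "real_vec x = (\<chi> i. of_rat (x $ i))"

lemma real_vec_add: "real_vec (x + y) = real_vec x + real_vec y"
  by (simp add: real_vec_def vec_eq_iff of_rat_add)

lemma real_vec_eq_0: "real_vec x = 0 \<longleftrightarrow> x = 0"
  by (simp add: real_vec_def vec_eq_iff)

lemma real_vec_expo_vec: "real_vec (expo_vec u) = expo_vec u"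
  by (simp add: real_vec_def expo_vec_def vec_eq_iff)

lemma lex_val_add: "lex_val ps (u + v) = lex_val ps u + lex_val ps v"
  by (simp add: lex_val_def pairing_add lex_poly_add)

lemma lex_val_scale: "lex_val ps (c *s v) = lex_val ps v * [:c:]"
  by (simp add: lex_val_def pairing_scale lex_poly_mult)

lemma src_add: "src \<omega> (u + v) = src \<omega> u + src \<omega> v"
  by (simp add: src_def lex_val_add)

lemma tgt_add: "tgt \<tau> (u + v) = tgt \<tau> u + tgt \<tau> v"
  using lex_poly_add[of "\<lambda>p. [:pairing p u:]" "\<lambda>p. [:pairing p v:]" \<tau>]
  by (simp add: tgt_def pairing_add)

lemma src_zero [simp]: "src \<omega> 0 = 0"
  using src_add[of \<omega> 0 0] by simp

lemma tgt_zero [simp]: "tgt \<tau> 0 = 0"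
  using tgt_add[of \<tau> 0 0] by simp

lemma src_diff: "src \<omega> (u - v) = src \<omega> u - src \<omega> v"
  using src_add[of \<omega> "u - v" v] by simp

lemma tgt_diff: "tgt \<tau> (u - v) = tgt \<tau> u - tgt \<tau> v"
  using tgt_add[of \<tau> "u - v" v] by simp

lemma lex_val_eq_0:
  assumes "rat_basis ps" "lex_val ps v = 0"
  shows "v = 0"
proof (rule pairing_zero_imp_zero)
  show "vec.span (set ps) = UNIV" using assms(1) by (simp add: rat_basis_def)
  show "pairing p v = 0" if "p \<in> set ps" for p
    using lex_poly_eq_0[OF assms(2)[unfolded lex_val_def]] that by simp
qed

lemma src_eq_0: "rat_basis \<omega> \<Longrightarrow> src \<omega> v = 0 \<Longrightarrow> v = 0"
  using lex_val_eq_0 by (simp add: src_def)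

lemma tgt_eq_0:
  assumes "rat_basis \<tau>" "tgt \<tau> v = 0"
  shows "v = 0"
proof (rule pairing_zero_imp_zero)
  show "vec.span (set \<tau>) = UNIV" using assms(1) by (simp add: rat_basis_def)
  show "pairing p v = 0" if "p \<in> set \<tau>" for p
    using lex_poly_eq_0[OF assms(2)[unfolded tgt_def]] that by fastforce
qed

lemma inj_lex_val:
  assumes "rat_basis ps"
  shows "inj (lex_val ps)"
proof (rule injI)
  fix u v assume "lex_val ps u = lex_val ps v"
  then have "lex_val ps (u - v) = 0" using lex_val_add[of ps "u - v" v] by simp
  then show "u = v" using lex_val_eq_0[OF assms] by fastforce
qed

lemma less_const_poly: "[:a:] < [:b:] \<longleftrightarrow> a < (b :: 'a::linordered_idom)"
  by (auto simp: less_poly_def pos_poly_pCons)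

lemma rat_order_lex_val: "rat_order \<omega> u v \<longleftrightarrow> lex_val \<omega> u < lex_val \<omega> v"
  by (simp add: rat_order_def lex_val_def lexord_iff_lex_poly)

lemma rat_order_src: "rat_order \<omega> u v \<longleftrightarrow> src \<omega> u < src \<omega> v"
  by (simp add: rat_order_lex_val src_def less_const_poly)

lemma rat_order_tgt:
  fixes u v :: "real ^ 'n::finite"
  shows "rat_order \<tau> u v \<longleftrightarrow> tgt \<tau> u < tgt \<tau> v"
proof -
  have "rat_order \<tau> u v \<longleftrightarrow> (map (\<lambda>c. [:c:]) (map (\<lambda>p. pairing p u) \<tau>),
    map (\<lambda>c. [:c:]) (map (\<lambda>p. pairing p v) \<tau>)) \<in> lexord {(a, b). a < b}"
    unfolding rat_order_def by (rule lexord_map) (auto simp: less_const_poly inj_def)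
  also have "\<dots> \<longleftrightarrow> tgt \<tau> u < tgt \<tau> v"
    by (subst lexord_iff_lex_poly) (auto simp: tgt_def comp_def)
  finally show ?thesis .
qed

lemma rat_order_real_vec:
  fixes \<omega> :: "(rat ^ 'n::finite) list"
  shows "rat_order \<omega> x y \<longleftrightarrow> rat_order \<omega> (real_vec x) (real_vec y)"
proof -
  have "pairing p (real_vec x) = of_rat (pairing p x)" for p and x :: "rat ^ 'n"
    by (simp add: pairing_def real_vec_def of_rat_sum of_rat_mult)
  then have *: "map (\<lambda>p. pairing p (real_vec x)) \<omega> = map of_rat (map (\<lambda>p. pairing p x) \<omega>)" for x
    by simp
  show ?thesis unfolding rat_order_def *
    by (rule lexord_map) (auto simp: inj_def of_rat_less)
qed

text \<open>Row \<open>i\<close> of \<open>Tuv\<^sup>t\<close> is \<open>\<langle>\<tau>\<^sub>i, u\<rangle>\<close> times \<open>v\<close>, so its value under \<open>lex_val \<omega>\<close> is the coefficient of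
  the \<open>i\<close>-th power of \<open>Y\<close>, from the top, in \<open>tgt \<tau> u * src \<omega> v\<close>. Equal rows have to be recognised by
  their values, which is where the basis property enters.\<close>
lemma facet_lexord_iff:
  assumes "rat_basis \<omega>"
  shows "(map (\<lambda>t. pairing t u *s v) \<tau>, map (\<lambda>t. pairing t v *s u) \<tau>)
      \<in> lexord {(x, y). rat_order \<omega> x y} \<longleftrightarrow> tgt \<tau> u * src \<omega> v < tgt \<tau> v * src \<omega> u"
proof -
  have row: "lex_poly (map (lex_val \<omega>) (map (\<lambda>t. pairing t u *s v) \<tau>)) = tgt \<tau> u * src \<omega> v" for u v
    using lex_poly_mult[of "lex_val \<omega> v" "\<lambda>t. [:pairing t u:]" \<tau>]
    by (simp only: tgt_def src_def map_map comp_def lex_val_scale mult.commute)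
  have "(map (\<lambda>t. pairing t u *s v) \<tau>, map (\<lambda>t. pairing t v *s u) \<tau>)
      \<in> lexord {(x, y). rat_order \<omega> x y} \<longleftrightarrow>
    (map (lex_val \<omega>) (map (\<lambda>t. pairing t u *s v) \<tau>), map (lex_val \<omega>) (map (\<lambda>t. pairing t v *s u) \<tau>))
      \<in> lexord {(x, y). x < y}"
    by (rule lexord_map) (auto simp: inj_lex_val[OF assms] rat_order_lex_val)
  also have "\<dots> \<longleftrightarrow> tgt \<tau> u * src \<omega> v < tgt \<tau> v * src \<omega> u"
    unfolding row[symmetric] by (rule lexord_iff_lex_poly) simp
  finally show ?thesis .
qed

definition lex2 :: "('a \<Rightarrow> 'r::linorder) \<Rightarrow> ('a \<Rightarrow> 'r) \<Rightarrow> 'a \<Rightarrow> 'a \<Rightarrow> bool" where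
  "lex2 f g x y \<longleftrightarrow> f x < f y \<or> f x = f y \<and> g x < g y"

lemma term_order_lex2:
  fixes f g :: "rat ^ 'n::finite \<Rightarrow> 'r::linordered_ab_group_add"
  assumes f: "\<And>x y. f (x + y) = f x + f y" and g: "\<And>x y. g (x + y) = g x + g y"
    and g0: "\<And>x. g x = 0 \<Longrightarrow> x = 0" and pos: "\<And>i. 0 < f (axis i 1)"
  shows "term_order (lex2 f g)"
proof -
  have "x = y" if "g x = g y" for x y using g[of "x - y" y] g0[of "x - y"] that by simp
  then have "totalp (lex2 f g)" unfolding lex2_def by (intro totalpI) (metis linorder_neqE)
  moreover have "f 0 = 0" using f[of 0 0] by simp
  moreover have "transp (lex2 f g)" unfolding lex2_def by (intro transpI) auto
  ultimately show ?thesis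
    unfolding term_order_def group_order_def using pos by (auto simp: lex2_def irreflp_def f g)
qed

section \<open>The generic walk\<close>

lemma cross_product_identity:
  fixes a b c a' b' d :: "'a::comm_ring_1"
  shows "a * (a' * b - c * b') = a' * (a * b - c * d) + (- c) * (a * b' - a' * d)"
  by (simp add: left_diff_distrib right_diff_distrib mult_ac del: ideal.scale_scale)

locale generic_walk =
  fixes I :: "('n::finite, 'k::field) mpoly set"
    and \<omega> \<tau> :: "(rat ^ 'n) list"
  assumes I: "ideal.subspace I"
    and basis: "rat_basis \<omega>" "rat_basis \<tau>"
    and term_orders: "term_order (rat_order \<omega>)" "term_order (rat_order \<tau>)"
begin

abbreviation A :: "real ^ 'n \<Rightarrow> real poly poly" where "A \<equiv> src \<omega>"
abbreviation B :: "real ^ 'n \<Rightarrow> real poly poly" where "B \<equiv> tgt \<tau>"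
abbreviation C :: "(real ^ 'n) set" where "C \<equiv> order_cone \<omega> \<tau>"
abbreviation ev :: "'n expo \<Rightarrow> real ^ 'n" where "ev \<equiv> expo_vec"

text \<open>For \<open>w\<close> in the cone and on the segment from \<open>A\<close> to \<open>B\<close> this is, up to a positive factor, the weight that
  vanishes on \<open>w\<close>.\<close>
definition wt :: "real ^ 'n \<Rightarrow> real ^ 'n \<Rightarrow> real poly poly" where
  "wt w v = A w * B v - A v * B w"

text \<open>The orders just before and just after the crossing of the facet normal to \<open>w\<close>: ties of
  the weight on the facet are broken towards the source and the target of the walk.\<close>
definition before :: "real ^ 'n \<Rightarrow> rat ^ 'n \<Rightarrow> rat ^ 'n \<Rightarrow> bool" where
  "before w = lex2 (\<lambda>x. wt w (real_vec x)) (\<lambda>x. A (real_vec x))"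

definition after :: "real ^ 'n \<Rightarrow> rat ^ 'n \<Rightarrow> rat ^ 'n \<Rightarrow> bool" where
  "after w = lex2 (\<lambda>x. wt w (real_vec x)) (\<lambda>x. B (real_vec x))"

lemma in_cone_iff: "v \<in> C \<longleftrightarrow> 0 < A v \<and> B v < 0"
  by (simp add: order_cone_def rat_order_src[of \<omega>] rat_order_tgt[of \<tau>])

lemma facet_less_iff:
  "facet_less I \<omega> \<tau> u v \<longleftrightarrow> u \<in> bd_ideal I \<inter> C \<and> v \<in> bd_ideal I \<inter> C \<and> 0 < wt u v"
  unfolding facet_less_def facet_lexord_iff[OF basis(1)] wt_def by (simp add: mult.commute)

lemma wt_add: "wt w (u + v) = wt w u + wt w v"
  by (simp add: wt_def src_add tgt_add algebra_simps)

lemma wt_diff: "wt w (u - v) = wt w u - wt w v"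
  by (simp add: wt_def src_diff tgt_diff algebra_simps)

lemma wt_antisym: "wt u v = - wt v u"
  by (simp add: wt_def)

lemma expo_less_src: "expo_less (rat_order \<omega>) v u \<longleftrightarrow> 0 < A (ev u - ev v)"
  by (simp add: expo_less_def rat_order_real_vec[of \<omega>] rat_order_src real_vec_expo_vec src_diff)

lemma expo_less_tgt: "expo_less (rat_order \<tau>) v u \<longleftrightarrow> 0 < B (ev u - ev v)"
  by (simp add: expo_less_def rat_order_real_vec[of \<tau>] rat_order_tgt real_vec_expo_vec tgt_diff)

lemma expo_less_before:
  "expo_less (before w) v u \<longleftrightarrow>
    0 < wt w (ev u - ev v) \<or> wt w (ev u - ev v) = 0 \<and> 0 < A (ev u - ev v)"
  by (auto simp: expo_less_def before_def lex2_def real_vec_expo_vec wt_diff src_diff)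

lemma expo_less_after:
  "expo_less (after w) v u \<longleftrightarrow>
    0 < wt w (ev u - ev v) \<or> wt w (ev u - ev v) = 0 \<and> 0 < B (ev u - ev v)"
  by (auto simp: expo_less_def after_def lex2_def real_vec_expo_vec wt_diff tgt_diff)

lemma axis_positive:
  shows "0 < A (real_vec (axis i 1))" "0 < B (real_vec (axis i 1))"
proof -
  have 0: "real_vec (0 :: rat ^ 'n) = 0" by (simp add: real_vec_eq_0)
  have "rat_order \<omega> (0 :: rat ^ 'n) (axis i 1)" "rat_order \<tau> (0 :: rat ^ 'n) (axis i 1)"
    using term_orders by (simp_all add: term_order_def)
  then show "0 < A (real_vec (axis i 1))" "0 < B (real_vec (axis i 1))"
    unfolding rat_order_real_vec[of \<omega>] rat_order_real_vec[of \<tau>]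
      rat_order_src[of \<omega>] rat_order_tgt[of \<tau>]
    by (simp_all add: 0)
qed

lemma wt_positive:
  assumes "w \<in> C" "0 \<le> A v" "0 \<le> B v" "0 < A v \<or> 0 < B v"
  shows "0 < wt w v"
proof -
  have w: "0 < A w" "0 < - B w" using assms(1) by (auto simp: in_cone_iff)
  have "0 \<le> A w * B v" "0 \<le> A v * - B w"
    by (rule mult_nonneg_nonneg; use assms(2,3) w in \<open>simp only: less_imp_le\<close>)+
  moreover have "0 < A w * B v \<or> 0 < A v * - B w" using assms(4) w by (blast intro: mult_pos_pos)
  ultimately have "0 < A w * B v + A v * - B w" by (auto intro: add_pos_nonneg add_nonneg_pos)
  then show ?thesis by (simp add: wt_def)
qed

lemma term_order_before:
  assumes "w \<in> C"
  shows "term_order (before w)"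
  unfolding before_def
proof (rule term_order_lex2)
  show "0 < wt w (real_vec (axis i 1))" for i
    using wt_positive[OF assms] axis_positive[of i] by simp
  show "x = 0" if "A (real_vec x) = 0" for x
    using src_eq_0[OF basis(1) that] real_vec_eq_0 by blast
qed (simp_all add: real_vec_add src_add wt_add)

lemma term_order_after:
  assumes "w \<in> C"
  shows "term_order (after w)"
  unfolding after_def
proof (rule term_order_lex2)
  show "0 < wt w (real_vec (axis i 1))" for i
    using wt_positive[OF assms] axis_positive[of i] by simp
  show "x = 0" if "B (real_vec x) = 0" for x
    using tgt_eq_0[OF basis(2) that] real_vec_eq_0 by blast
qed (simp_all add: real_vec_add tgt_add wt_add)

text \<open>The value of a fixed vector is affine along the segment, so a vector that is positive at the
  end stays nonnegative once it has become so.\<close>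
lemma wt_nonneg_trans:
  assumes "w \<in> C" "w' \<in> C" "0 \<le> wt w w'" "0 < B v" "0 \<le> wt w v"
  shows "0 \<le> wt w' v" and "0 < wt w w' \<or> 0 < wt w v \<Longrightarrow> 0 < wt w' v"
proof -
  have pos: "0 < A w" "0 < A w'" "B w < 0" "B w' < 0" using assms(1,2) by (auto simp: in_cone_iff)
  have eq: "A w * wt w' v = A w' * wt w v + (- A v) * wt w w'"
    unfolding wt_def by (rule cross_product_identity)
  show "0 \<le> wt w' v"
  proof (cases "0 \<le> A v")
    case True
    then show ?thesis using wt_positive[OF assms(2), of v] assms(4) by simp
  next
    case False
    then have "0 \<le> A w * wt w' v"
      unfolding eq using pos assms(3,5) by (intro add_nonneg_nonneg mult_nonneg_nonneg) auto
    then show ?thesis using pos(1) by (simp add: zero_le_mult_iff)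
  qed
  show "0 < wt w' v" if strict: "0 < wt w w' \<or> 0 < wt w v"
  proof (cases "0 \<le> A v")
    case True
    then show ?thesis using wt_positive[OF assms(2), of v] assms(4) by simp
  next
    case False
    have le: "0 \<le> A w' * wt w v" "0 \<le> (- A v) * wt w w'"
      by (rule mult_nonneg_nonneg; use False pos assms(3,5) in simp)+
    have "0 < A w' * wt w v \<or> 0 < (- A v) * wt w w'"
      using strict False pos(2) mult_pos_pos[of "- A v" "wt w w'"] by (auto intro: mult_pos_pos)
    then have "0 < A w * wt w' v" unfolding eq using le by (auto intro: add_pos_nonneg add_nonneg_pos)
    then show ?thesis using pos(1) by (simp add: zero_less_mult_iff)
  qed
qed

lemma facet_order_trans:
  assumes "u \<in> C" "v \<in> C" "x \<in> C" "0 \<le> wt u v" "0 \<le> wt v x"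
  shows "0 \<le> wt u x" and "0 < wt u v \<or> 0 < wt v x \<Longrightarrow> 0 < wt u x"
proof -
  have pos: "0 < A u" "0 < A v" "0 < A x" using assms(1-3) by (auto simp: in_cone_iff)
  have "A v * wt u x = A u * wt v x + (- A x) * wt v u"
    unfolding wt_def by (rule cross_product_identity)
  then have eq: "A v * wt u x = A u * wt v x + A x * wt u v" using wt_antisym[of v u] by simp
  have le: "0 \<le> A u * wt v x" "0 \<le> A x * wt u v" using pos assms(4,5) by auto
  then have "0 \<le> A v * wt u x" unfolding eq by simp
  then show "0 \<le> wt u x" using pos(2) by (simp add: zero_le_mult_iff)
  show "0 < wt u x" if "0 < wt u v \<or> 0 < wt v x"
  proof -
    have "0 < A u * wt v x \<or> 0 < A x * wt u v" using that pos by (auto intro: mult_pos_pos)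
    then have "0 < A v * wt u x" unfolding eq using le by (auto intro: add_pos_nonneg add_nonneg_pos)
    then show ?thesis using pos(2) by (simp add: zero_less_mult_iff)
  qed
qed

lemma bd_set_in_bd_ideal:
  assumes "term_order lt" "marked_reduced_groebner_basis lt I G" "x \<in> bd_set G"
  shows "x \<in> bd_ideal I"
  using assms unfolding bd_ideal_def by blast

lemma in_bd_setI: "(u, g) \<in> G \<Longrightarrow> v \<in> keys g \<Longrightarrow> v \<noteq> u \<Longrightarrow> ev u - ev v \<in> bd_set G"
  unfolding bd_set_def bd_poly_def by fastforce

lemma in_bd_setE:
  assumes "x \<in> bd_set G"
  obtains u g v where "(u, g) \<in> G" "v \<in> keys g" "v \<noteq> u" "x = ev u - ev v"
  using assms unfolding bd_set_def bd_poly_def by auto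

lemma finite_bd_set:
  fixes G :: "('n, 'k) marked set"
  assumes "finite G"
  shows "finite (bd_set G)"
proof -
  have "finite (bd_poly m)" for m :: "('n, 'k) marked"
  proof -
    have "bd_poly m = (\<lambda>v. ev (fst m) - ev v) ` (keys (snd m) - {fst m})"
      by (auto simp: bd_poly_def split: prod.splits)
    then show ?thesis by simp
  qed
  then show ?thesis unfolding bd_set_def using assms by blast
qed

lemma ev_diff_nonzero:
  assumes "v \<noteq> u"
  shows "A (ev u - ev v) \<noteq> 0" "B (ev u - ev v) \<noteq> 0"
  using src_eq_0[OF basis(1), of "ev u - ev v"] tgt_eq_0[OF basis(2), of "ev u - ev v"] assms by auto

fun current :: "(real ^ 'n) option \<Rightarrow> rat ^ 'n \<Rightarrow> rat ^ 'n \<Rightarrow> bool" where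
  "current None = rat_order \<omega>"
| "current (Some w) = after w"

definition position :: "(real ^ 'n) option \<Rightarrow> bool" where
  "position w \<longleftrightarrow> (\<forall>x. w = Some x \<longrightarrow> x \<in> bd_ideal I \<inter> C)"

lemma position_Some [simp]: "position (Some x) \<longleftrightarrow> x \<in> bd_ideal I \<inter> C"
  by (simp add: position_def)

lemma term_order_current:
  assumes "position w"
  shows "term_order (current w)"
  using assms term_orders(1) term_order_after by (cases w) auto

text \<open>The vectors of \<open>\<partial>(G)\<close> are positive for the current order, so one of them that lies in the
  cone changes its sign only later on the segment.\<close>
lemma candidate_iff:
  assumes w: "position w" and G: "marked_reduced_groebner_basis (current w) I G" and x: "x \<in> bd_set G"
  shows "x \<in> walk_candidates I \<omega> \<tau> w G \<longleftrightarrow> x \<in> C"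
proof
  assume xC: "x \<in> C"
  have xI: "x \<in> bd_ideal I" using bd_set_in_bd_ideal[OF term_order_current[OF w] G x] .
  have gb: "marked_gb (current w) I G"
    using G monomial_order.marked_reduced_iff[OF monomial_order.intro[OF term_order_current[OF w]] I] by blast
  have "facet_less_opt I \<omega> \<tau> w x"
  proof (cases w)
    case None
    then show ?thesis using xC xI by simp
  next
    case (Some y)
    obtain u g v where *: "(u, g) \<in> G" "v \<in> keys g" "v \<noteq> u" "x = ev u - ev v"
      using in_bd_setE[OF x] .
    have "expo_less (after y) v u" using marked_gb_less[OF gb *(1-3)] Some by simp
    then have "0 < wt y x" using xC by (auto simp: expo_less_after *(4)[symmetric] in_cone_iff)
    then show ?thesis using xC xI w Some by (simp add: facet_less_iff)
  qed
  then show "x \<in> walk_candidates I \<omega> \<tau> w G" using x xC by (simp add: walk_candidates_def)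
qed (simp add: walk_candidates_def)

text \<open>The functional at the current position is a nonnegative combination of those at the two ends,
  with ties broken by the target. So a vector that is positive at the current position and
  negative for the target is positive for the source.\<close>
lemma current_positive:
  assumes w: "position w" and "expo_less (current w) v u" "B (ev u - ev v) < 0"
  shows "ev u - ev v \<in> C"
proof (cases w)
  case None
  then show ?thesis using assms by (simp add: expo_less_src in_cone_iff)
next
  case (Some y)
  let ?x = "ev u - ev v"
  have y: "0 < A y" "B y < 0" using w Some by (auto simp: in_cone_iff)
  have "0 < wt y ?x" using assms Some by (auto simp: expo_less_after)
  moreover have "A y * B ?x < 0" using y(1) assms(3) by (simp add: mult_pos_neg)
  ultimately have "A ?x * B y < 0" unfolding wt_def by simp
  then have "0 < A ?x" using y(2) by (metis mult_less_0_iff not_less_iff_gr_or_eq)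
  then show ?thesis using assms(3) by (simp add: in_cone_iff)
qed

text \<open>A vector of \<open>\<partial>(G)\<close> that is negative for the target order would be a candidate.\<close>
theorem halt_correct:
  assumes w: "position w" and G: "marked_reduced_groebner_basis (current w) I G"
    and none: "walk_candidates I \<omega> \<tau> w G = {}"
  shows "marked_reduced_groebner_basis (rat_order \<tau>) I G"
proof -
  note red = monomial_order.marked_reduced_iff[OF monomial_order.intro I]
  have gb: "marked_gb (current w) I G" and auto: "autoreduced G"
    using G red[OF term_order_current[OF w]] by auto
  have "marked_gb (rat_order \<tau>) I G"
  proof (rule marked_gb_change_order[OF gb])
    fix u g v assume *: "(u, g) \<in> G" "v \<in> keys g" "v \<noteq> u"
    have "ev u - ev v \<notin> C" using candidate_iff[OF w G in_bd_setI[OF *]] none by simp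
    then have "\<not> B (ev u - ev v) < 0" using current_positive[OF w marked_gb_less[OF gb *]] by blast
    then show "expo_less (rat_order \<tau>) v u"
      using ev_diff_nonzero(2)[OF *(3)] by (simp add: expo_less_tgt)
  qed
  then show ?thesis using red[OF term_orders(2)] auto by blast
qed

lemma candidate_after_position:
  assumes "position (Some w)" "w' \<in> walk_candidates I \<omega> \<tau> (Some w) G"
  shows "0 < wt w w'"
  using assms by (simp add: walk_candidates_def facet_less_iff)

text \<open>No vector of \<open>\<partial>(G)\<close> changes sign between the current position and the first candidate:
  those that decrease along the segment are candidates themselves and cross no earlier than
  \<open>w'\<close>, and the others stay positive.\<close>
lemma marked_gb_before:
  assumes w: "position w" and G: "marked_reduced_groebner_basis (current w) I G"
    and w': "w' \<in> walk_candidates I \<omega> \<tau> w G"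
    and minimal: "\<forall>v \<in> walk_candidates I \<omega> \<tau> w G. \<not> facet_less I \<omega> \<tau> v w'"
  shows "marked_gb (before w') I G"
proof -
  note to = term_order_current[OF w]
  have gb: "marked_gb (current w) I G"
    using G monomial_order.marked_reduced_iff[OF monomial_order.intro[OF to] I] by blast
  have w'C: "w' \<in> C" and w'bd: "w' \<in> bd_set G" using w' by (auto simp: walk_candidates_def)
  have w'I: "w' \<in> bd_ideal I" using bd_set_in_bd_ideal[OF to G w'bd] .
  show ?thesis
  proof (rule marked_gb_change_order[OF gb])
    fix u g v assume *: "(u, g) \<in> G" "v \<in> keys g" "v \<noteq> u"
    define x where "x = ev u - ev v"
    have xbd: "x \<in> bd_set G" unfolding x_def by (rule in_bd_setI[OF *])
    have xI: "x \<in> bd_ideal I" using bd_set_in_bd_ideal[OF to G xbd] .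
    have less: "expo_less (current w) v u" using marked_gb_less[OF gb *] .
    have nz: "A x \<noteq> 0" "B x \<noteq> 0" using ev_diff_nonzero[OF *(3)] by (auto simp: x_def)
    have "0 < wt w' x \<or> wt w' x = 0 \<and> 0 < A x"
    proof (cases "B x < 0")
      case True
      then have xC: "x \<in> C" using current_positive[OF w less] by (simp add: x_def)
      then have "\<not> facet_less I \<omega> \<tau> x w'" using minimal candidate_iff[OF w G xbd] by blast
      then have "\<not> 0 < wt x w'" using xC xI w'C w'I by (simp add: facet_less_iff)
      then have "0 \<le> wt w' x" using wt_antisym[of x w'] by simp
      then show ?thesis using xC by (auto simp: in_cone_iff)
    next
      case False
      then have B: "0 < B x" using nz by simp
      have "0 < wt w' x"
      proof (cases w)
        case None
        then have "0 < A x" using less by (simp add: expo_less_src x_def)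
        then show ?thesis using wt_positive[OF w'C] B by simp
      next
        case (Some y)
        have "0 \<le> wt y x" using less Some by (auto simp: expo_less_after x_def)
        moreover have "0 < wt y w'" using candidate_after_position[of y w' G] w w' Some by simp
        ultimately show ?thesis using wt_nonneg_trans(2)[of y w' x] w Some w'C B by auto
      qed
      then show ?thesis by blast
    qed
    then show "expo_less (before w') v u" by (simp add: expo_less_before x_def)
  qed
qed

text \<open>The vectors equivalent to \<open>w'\<close> in the facet preorder are those on which \<open>wt w'\<close> vanishes, so
  the forms of the algorithm are the parts of top weight.\<close>
theorem cross_correct:
  assumes w: "position w" and G: "marked_reduced_groebner_basis (current w) I G"
    and w': "w' \<in> walk_candidates I \<omega> \<tau> w G"
    and minimal: "\<forall>v \<in> walk_candidates I \<omega> \<tau> w G. \<not> facet_less I \<omega> \<tau> v w'"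
    and H: "marked_reduced_groebner_basis (rat_order \<tau>) (ideal.span (facet_form I \<omega> \<tau> w' ` G)) H"
    and rem: "\<forall>(u, f) \<in> H. is_remainder G f (rem f)"
  shows "marked_gb (after w') I ((\<lambda>(u, f). (u, f - rem f)) ` H)"
proof -
  have w'C: "w' \<in> C" and w'bd: "w' \<in> bd_set G" using w' by (auto simp: walk_candidates_def)
  note to = term_order_current[OF w]
  have w'I: "w' \<in> bd_ideal I" using bd_set_in_bd_ideal[OF to G w'bd] .
  have gb: "marked_gb (before w') I G" by (rule marked_gb_before[OF w G w' minimal])
  interpret crossing: facet_crossing "before w'" "after w'" "rat_order \<tau>" "\<lambda>u. wt w' (ev u)" I G
  proof unfold_locales
    show "term_order (before w')" by (rule term_order_before[OF w'C])
    show "term_order (rat_order \<tau> :: rat ^ 'n \<Rightarrow> _)" by (rule term_orders)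
  qed (auto simp: expo_vec_add wt_add expo_less_before expo_less_after expo_less_tgt wt_diff I gb)
  have "facet_form I \<omega> \<tau> w' m = crossing.form m" if m: "m \<in> G" for m
  proof -
    obtain u g where ug: "m = (u, g)" by (cases m)
    have cond: "(ev u - ev v \<in> C \<and> \<not> facet_less I \<omega> \<tau> (ev u - ev v) w' \<and>
      \<not> facet_less I \<omega> \<tau> w' (ev u - ev v)) \<longleftrightarrow> wt w' (ev v) = wt w' (ev u)"
      if v: "v \<in> keys g" "v \<noteq> u" for v
    proof -
      let ?x = "ev u - ev v"
      have xI: "?x \<in> bd_ideal I"
        using bd_set_in_bd_ideal[OF to G in_bd_setI] m v ug by blast
      \<comment> \<open>On the facet, the signs of source and target are opposite.\<close>
      have "?x \<in> C" if z: "wt w' ?x = 0"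
      proof -
        have "expo_less (before w') v u" using marked_gb_less[OF gb _ v] m ug by blast
        then have Ax: "0 < A ?x" using z by (simp add: expo_less_before)
        then have "A ?x * B w' < 0" using w'C by (simp add: in_cone_iff mult_pos_neg)
        then have "A w' * B ?x < 0" using z by (simp add: wt_def)
        then have "B ?x < 0" using w'C by (auto simp: in_cone_iff mult_less_0_iff)
        then show ?thesis using Ax by (simp add: in_cone_iff)
      qed
      moreover have "facet_less I \<omega> \<tau> ?x w' \<longleftrightarrow> wt w' ?x < 0" if "?x \<in> C"
        using that xI w'C w'I wt_antisym[of ?x w'] by (simp add: facet_less_iff)
      moreover have "facet_less I \<omega> \<tau> w' ?x \<longleftrightarrow> 0 < wt w' ?x" if "?x \<in> C"
        using that xI w'C w'I by (simp add: facet_less_iff)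
      ultimately have "(?x \<in> C \<and> \<not> facet_less I \<omega> \<tau> ?x w' \<and> \<not> facet_less I \<omega> \<tau> w' ?x)
        \<longleftrightarrow> wt w' ?x = 0" by auto
      then show ?thesis by (simp add: wt_diff) (metis)
    qed
    have "lookup (facet_form I \<omega> \<tau> w' m) a = lookup (crossing.form m) a" for a
    proof -
      let ?P = "\<lambda>v. ev u - ev v \<in> C \<and> \<not> facet_less I \<omega> \<tau> (ev u - ev v) w' \<and>
        \<not> facet_less I \<omega> \<tau> w' (ev u - ev v)"
      have "facet_form I \<omega> \<tau> w' m = single u (lookup g u)
          + restrict_keys (\<lambda>v. v \<noteq> u \<and> wt w' (ev v) = wt w' (ev u)) g"
      proof -
        have "{v \<in> keys g - {u}. ?P v} = {v \<in> keys g. v \<noteq> u \<and> wt w' (ev v) = wt w' (ev u)}"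
          using cond by blast
        then show ?thesis by (simp add: facet_form_def restrict_keys_def ug)
      qed
      then show ?thesis
        by (simp add: crossing.form_def ug lookup_add lookup_single lookup_restrict_keys when_def)
    qed
    then show ?thesis by (rule poly_mapping_eqI)
  qed
  then have "facet_form I \<omega> \<tau> w' ` G = crossing.form ` G" by (rule image_cong[OF refl])
  then have "marked_reduced_groebner_basis (rat_order \<tau>) crossing.J H" using H by (simp add: crossing.J_def)
  then have "marked_gb (rat_order \<tau>) crossing.J H \<and> autoreduced H"
    using monomial_order.marked_reduced_iff[OF crossing.target crossing.J_subspace] by blast
  then show ?thesis using crossing.crossing_marked_gb rem by blast
qed

lemma minimal_candidate_exists:
  assumes "finite G" "walk_candidates I \<omega> \<tau> w G \<noteq> {}"
  shows "\<exists>w'\<in>walk_candidates I \<omega> \<tau> w G. \<forall>v\<in>walk_candidates I \<omega> \<tau> w G. \<not> facet_less I \<omega> \<tau> v w'"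
proof -
  let ?V = "walk_candidates I \<omega> \<tau> w G"
  have fin: "finite ?V" using finite_bd_set[OF assms(1)] by (simp add: walk_candidates_def)
  have irrefl: "\<not> facet_less I \<omega> \<tau> v v" for v by (simp add: facet_less_iff wt_def)
  have trans: "facet_less I \<omega> \<tau> u x" if "facet_less I \<omega> \<tau> u v" "facet_less I \<omega> \<tau> v x" for u v x
    using that facet_order_trans(2)[of u v x] by (auto simp: facet_less_iff)
  have "asymp_on ?V (facet_less I \<omega> \<tau>)" using irrefl trans by (intro asymp_onI) metis
  moreover have "transp_on ?V (facet_less I \<omega> \<tau>)" by (intro transp_onI) (rule trans)
  ultimately obtain m where "m \<in> ?V" "\<forall>v\<in>?V. v \<noteq> m \<longrightarrow> \<not> facet_less I \<omega> \<tau> v m"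
    using Finite_Set.bex_min_element[OF fin _ _ assms(2), of "facet_less I \<omega> \<tau>"] by auto
  then show ?thesis using irrefl by metis
qed

theorem walk_progress:
  assumes w: "position w" and G: "marked_reduced_groebner_basis (current w) I G"
  shows "\<exists>s. walk_step I \<omega> \<tau> (Walk w G) s"
proof (cases "walk_candidates I \<omega> \<tau> w G = {}")
  case True
  then show ?thesis by (meson walk_step.halt)
next
  case False
  note mo = monomial_order.intro[OF term_order_current[OF w]]
  have gb: "marked_gb (current w) I G" using G monomial_order.marked_reduced_iff[OF mo I] by blast
  obtain w' where w': "w' \<in> walk_candidates I \<omega> \<tau> w G"
    "\<forall>v\<in>walk_candidates I \<omega> \<tau> w G. \<not> facet_less I \<omega> \<tau> v w'"
    using minimal_candidate_exists[OF marked_gb_finite[OF gb] False] by blast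
  obtain H where H: "marked_reduced_groebner_basis (rat_order \<tau>)
      (ideal.span (facet_form I \<omega> \<tau> w' ` G)) H"
    using monomial_order.marked_reduced_exists[OF monomial_order.intro[OF term_orders(2)]
        ideal.subspace_span] by blast
  define rem where "rem f = (SOME r. is_remainder G f r)" for f
  have "is_remainder G f (rem f)" for f
    unfolding rem_def
    by (rule someI_ex[OF monomial_order.remainder_exists[OF mo marked_gb_well_marked[OF gb]]])
  then have "\<forall>(u, f) \<in> H. is_remainder G f (rem f)" by blast
  then show ?thesis using walk_step.cross[OF w' H _ refl] by blast
qed

end

context generic_walk
begin

section \<open>Partial correctness and progress\<close>

fun walk_inv :: "(real ^ 'n, ('n, 'k) marked) walk_state \<Rightarrow> bool" where
  "walk_inv (Walk w G) \<longleftrightarrow> position w \<and> marked_reduced_groebner_basis (current w) I G"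
| "walk_inv (Autored w G) \<longleftrightarrow> position (Some w) \<and> marked_gb (after w) I G"
| "walk_inv (Output G) \<longleftrightarrow> marked_reduced_groebner_basis (rat_order \<tau>) I G"

lemma monomial_order_after: "position (Some w) \<Longrightarrow> monomial_order (after w)"
  by (intro monomial_order.intro term_order_after) simp

lemma walk_inv_step:
  assumes "walk_step I \<omega> \<tau> s s'" "walk_inv s"
  shows "walk_inv s'"
  using assms
proof cases
  case (halt w G)
  then show ?thesis using halt_correct[of w G] assms(2) by simp
next
  case (cross w' w G H rem H')
  then have w: "position w" "marked_reduced_groebner_basis (current w) I G" using assms(2) by simp_all
  have "w' \<in> bd_set G" "w' \<in> C" using cross(3) by (auto simp: walk_candidates_def)
  then have "position (Some w')" using bd_set_in_bd_ideal[OF term_order_current[OF w(1)] w(2)] by simp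
  moreover have "marked_gb (after w') I H'"
    unfolding cross(7) by (rule cross_correct[OF w cross(3-6)])
  ultimately show ?thesis using cross(2) by simp
next
  case (reduce G G' w)
  then have "position (Some w)" "marked_gb (after w) I G" using assms(2) by simp_all
  then show ?thesis
    using monomial_order.autoreduction_step_marked_gb[OF monomial_order_after I] reduce by simp
next
  case (loop G w)
  then have "position (Some w)" "marked_gb (after w) I G" using assms(2) by simp_all
  then show ?thesis
    using monomial_order.marked_reduced_iff[OF monomial_order_after I] loop by simp
qed

lemma walk_inv_steps: "(walk_step I \<omega> \<tau>)\<^sup>*\<^sup>* s s' \<Longrightarrow> walk_inv s \<Longrightarrow> walk_inv s'"
  by (induction rule: rtranclp_induct) (auto intro: walk_inv_step)

lemma walk_inv_progress:
  assumes "walk_inv s"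
  shows "(\<exists>G. s = Output G) \<or> (\<exists>s'. walk_step I \<omega> \<tau> s s')"
proof (cases s)
  case (Walk w G)
  then show ?thesis using walk_progress assms by simp
next
  case (Autored w G)
  show ?thesis
  proof (cases "autoreduced G")
    case True
    then show ?thesis using Autored walk_step.loop by blast
  next
    case False
    then obtain G' where "autoreduction_step G G'" using autoreduction_step_exists by blast
    then show ?thesis using Autored walk_step.reduce by blast
  qed
qed simp

section \<open>Termination\<close>

lemma after_iff:
  "after w x y \<longleftrightarrow> 0 < wt w (real_vec y - real_vec x)
    \<or> wt w (real_vec y - real_vec x) = 0 \<and> 0 < B (real_vec y - real_vec x)"
  by (auto simp: after_def lex2_def wt_diff tgt_diff)

text \<open>The sign of a fixed vector changes at most once along the segment, so the orders met along
  an infinite walk converge pointwise.\<close>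
lemma term_order_limit:
  fixes p :: "nat \<Rightarrow> real ^ 'n"
  assumes p: "\<And>i. p i \<in> C" and mono: "\<And>i j. i \<le> j \<Longrightarrow> 0 \<le> wt (p i) (p j)"
  shows "term_order (\<lambda>x y. \<forall>\<^sub>F i in sequentially. after (p i) x y)" (is "term_order ?lim")
proof -
  have to: "term_order (after (p i))" for i by (rule term_order_after[OF p])
  then have go: "group_order (after (p i))" for i by (simp add: term_order_def)
  have "irreflp ?lim"
  proof (rule irreflpI)
    fix x
    have "\<not> after (p i) x x" for i using go[of i] by (simp add: group_order_def irreflp_def)
    then show "\<not> ?lim x x" by simp
  qed
  moreover have "transp ?lim"
  proof (rule transpI)
    fix x y z assume "?lim x y" "?lim y z"
    then show "?lim x z"
    proof eventually_elim
      case (elim i)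
      then show ?case using go[of i] unfolding group_order_def by (metis transpD)
    qed
  qed
  moreover have half: "?lim x y \<or> ?lim y x" if B: "0 < B (real_vec y - real_vec x)" for x y
  proof -
    let ?v = "real_vec y - real_vec x"
    show ?thesis
    proof (cases "\<exists>N. 0 \<le> wt (p N) ?v")
      case True
      then obtain N where N: "0 \<le> wt (p N) ?v" by blast
      have "after (p i) x y" if "N \<le> i" for i
        using wt_nonneg_trans(1)[OF p p mono[OF that] B N] B by (auto simp: after_iff)
      then show ?thesis by (auto simp: eventually_sequentially)
    next
      case False
      then have "wt (p i) ?v < 0" for i by (simp add: not_le)
      then have "after (p i) y x" for i by (simp add: after_iff wt_diff)
      then show ?thesis by simp
    qed
  qed
  have "totalp ?lim"
  proof (rule totalpI)
    fix x y :: "rat ^ 'n" assume "x \<noteq> y"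
    then have "real_vec (y - x) \<noteq> 0" by (simp add: real_vec_eq_0)
    moreover have "real_vec (y - x) = real_vec y - real_vec x"
      using real_vec_add[of "y - x" x] by simp
    ultimately have "B (real_vec y - real_vec x) \<noteq> 0" using tgt_eq_0[OF basis(2)] by metis
    then have "0 < B (real_vec y - real_vec x) \<or> 0 < B (real_vec x - real_vec y)"
      by (auto simp: tgt_diff)
    then show "?lim x y \<or> ?lim y x" using half by blast
  qed
  moreover have "?lim (x + z) (y + z)" if "?lim x y" for x y z
    using that by eventually_elim (use go in \<open>auto simp: group_order_def\<close>)
  moreover have "?lim 0 (axis i 1)" for i using to by (auto simp: term_order_def)
  ultimately show ?thesis unfolding term_order_def group_order_def by blast
qed

lemma autoreduction_terminates:
  assumes w: "position (Some w)" and gb: "\<And>i. marked_gb (after w) I (Gs i)"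
    and step: "\<And>i::nat. autoreduction_step (Gs i) (Gs (Suc i))"
  shows False
proof -
  note mo = monomial_order_after[OF w]
  have "(Gs (Suc i), Gs i) \<in> monomial_order.autoreduction_measure (after w)" for i
    by (rule monomial_order.autoreduction_step_decreases[OF mo gb step])
  then show False
    using monomial_order.wf_autoreduction_measure[OF mo] unfolding wf_iff_no_infinite_down_chain by blast
qed

text \<open>The limit of the orders along an infinite walk is a term order; its reduced basis \<open>K\<close> is
  finite, hence marked correctly by all late orders as well. So the walk is eventually
  confined to the single basis \<open>K\<close>, whose finitely many vectors cannot all be crossed
  at ever later times.\<close>
theorem walk_terminates:
  assumes s0: "s 0 = Walk None G" "marked_reduced_groebner_basis (rat_order \<omega>) I G"
    and steps: "\<And>i::nat. walk_step I \<omega> \<tau> (s i) (s (Suc i))"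
  shows False
proof -
  have inv: "walk_inv (s i)" for i
    by (induction i) (use s0 steps walk_inv_step in \<open>auto simp: position_def\<close>)
  \<comment> \<open>The shift by one skips the starting state, which carries no vector. The value at output
    states is arbitrary, since an infinite walk does not meet them.\<close>
  define p where "p i = (case s (Suc i) of Walk w G \<Rightarrow> the w | Autored w G \<Rightarrow> w | Output G \<Rightarrow> 0)" for i
  have state: "(\<exists>G. s (Suc i) = Walk (Some (p i)) G) \<or> (\<exists>G. s (Suc i) = Autored (p i) G)" for i
    using steps[of i] steps[of "Suc i"] by (cases rule: walk_step.cases) (auto simp: p_def elim: walk_step.cases)
  have pos: "position (Some (p i))" for i using state[of i] inv[of "Suc i"] by auto
  then have pC: "p i \<in> C" for i by simp
  have cross: "\<exists>H. s (Suc (Suc i)) = Autored (p (Suc i)) H \<and> p (Suc i) \<in> bd_set G \<and> 0 < wt (p i) (p (Suc i))"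
    if "s (Suc i) = Walk (Some (p i)) G" for i G
    using steps[of "Suc i"] unfolding that
  proof cases
    case halt
    then show ?thesis using state[of "Suc i"] by auto
  next
    case (cross w' H rem H')
    then have "p (Suc i) = w'" by (simp add: p_def)
    then show ?thesis
      using cross candidate_after_position[OF pos[of i], of w' G] by (simp add: walk_candidates_def)
  qed
  have stay: "p (Suc i) = p i" if "s (Suc i) = Autored (p i) G" for i G
    using steps[of "Suc i"] unfolding that by cases (auto simp: p_def)
  have step_le: "0 \<le> wt (p i) (p (Suc i))" for i
    using state[of i] cross[of i] stay[of i] by (auto simp: wt_def less_imp_le)
  have mono: "0 \<le> wt (p i) (p j)" if "i \<le> j" for i j
    using that
  proof (induction j rule: dec_induct)
    case (step n)
    then show ?case using facet_order_trans(1)[OF pC pC pC step.IH step_le] by simp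
  qed (simp add: wt_def)
  define lim where "lim x y \<longleftrightarrow> (\<forall>\<^sub>F i in sequentially. after (p i) x y)" for x y
  have lim: "term_order lim" unfolding lim_def by (rule term_order_limit[OF pC mono])
  note mo = monomial_order.intro[OF lim]
  obtain K where "marked_reduced_groebner_basis lim I K"
    using monomial_order.marked_reduced_exists[OF mo I] by blast
  then have K: "marked_gb lim I K" "autoreduced K"
    using monomial_order.marked_reduced_iff[OF mo I] by auto
  have "\<forall>\<^sub>F i in sequentially. \<forall>m\<in>K. \<forall>v\<in>keys (snd m) - {fst m}. expo_less (after (p i)) v (fst m)"
  proof (intro eventually_ball_finite ballI)
    show "finite K" by (rule marked_gb_finite[OF K(1)])
    fix m v assume "m \<in> K" "v \<in> keys (snd m) - {fst m}"
    then have "expo_less lim v (fst m)" using marked_gb_less[OF K(1), of "fst m" "snd m" v] by simp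
    then show "\<forall>\<^sub>F i in sequentially. expo_less (after (p i)) v (fst m)"
      by (simp add: expo_less_def lim_def)
  qed simp
  then obtain N where N: "\<And>i m v. N \<le> i \<Longrightarrow> m \<in> K \<Longrightarrow> v \<in> keys (snd m) - {fst m} \<Longrightarrow>
      expo_less (after (p i)) v (fst m)"
    unfolding eventually_sequentially by blast
  have K_late: "G = K" if "N \<le> i" "s (Suc i) = Walk (Some (p i)) G" for i G
  proof (rule monomial_order.marked_reduced_unique[OF monomial_order_after[OF pos[of i]] I])
    show "marked_reduced_groebner_basis (after (p i)) I G" using inv[of "Suc i"] that(2) by simp
    have "marked_gb (after (p i)) I K"
      by (rule marked_gb_change_order[OF K(1)]) (use N[OF that(1)] in fastforce)
    then show "marked_reduced_groebner_basis (after (p i)) I K"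
      using monomial_order.marked_reduced_iff[OF monomial_order_after[OF pos[of i]] I] K(2) by blast
  qed
  let ?P = "{i. N \<le> i \<and> (\<exists>G. s (Suc i) = Walk (Some (p i)) G)}"
  have crossing: "p (Suc i) \<in> bd_set K" "0 < wt (p i) (p (Suc i))" if "i \<in> ?P" for i
    using that cross[of i] K_late[of i] by auto
  have "p (Suc i) \<noteq> p (Suc j)" if "i < j" "j \<in> ?P" for i j
  proof -
    have "0 < wt (p (Suc i)) (p (Suc j))"
      using facet_order_trans(2)[OF pC pC pC mono[of "Suc i" j] step_le[of j]] crossing(2)[OF that(2)] that(1)
      by simp
    then show ?thesis by (auto simp: wt_def)
  qed
  then have "inj_on (\<lambda>i. p (Suc i)) ?P" by (intro linorder_inj_onI')
  moreover have "(\<lambda>i. p (Suc i)) ` ?P \<subseteq> bd_set K" using crossing(1) by (rule image_subsetI)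
  ultimately have "finite ?P" using finite_bd_set[OF marked_gb_finite[OF K(1)]] by (rule inj_on_finite)
  then obtain M where "\<forall>i\<in>?P. i < M" unfolding finite_nat_set_iff_bounded ..
  then have M: "i < M" if "i \<in> ?P" for i using that by (rule bspec)
  define L where "L = max M N"
  have late: "\<exists>G. s (Suc (L + i)) = Autored (p (L + i)) G" for i
  proof -
    have "N \<le> L + i" "\<not> L + i < M" by (simp_all add: L_def)
    then show ?thesis using M[of "L + i"] state[of "L + i"] by blast
  qed
  then obtain Gs where Gs: "\<And>i. s (Suc (L + i)) = Autored (p (L + i)) (Gs i)" by metis
  have p_late: "p (L + i) = p L" for i
    by (induction i) (use stay Gs in auto)
  have "autoreduction_step (Gs i) (Gs (Suc i))" for i
    using steps[of "Suc (L + i)"] Gs[of i] Gs[of "Suc i"] by (auto elim: walk_step.cases)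
  moreover have "marked_gb (after (p L)) I (Gs i)" for i
    using inv[of "Suc (L + i)"] Gs[of i] p_late[of i] by simp
  ultimately show False using autoreduction_terminates[OF pos[of L]] by blast
qed

end

theorem mainTheorem1:
  fixes I :: "('n::finite, 'k::field) mpoly set"
    and \<omega> \<tau> :: "(rat ^ 'n) list"
    and G :: "('n, 'k) marked set"
  assumes "ideal.subspace I"
    and "rat_basis \<omega>" and "rat_basis \<tau>"
    and "term_order (rat_order \<omega>)" and "term_order (rat_order \<tau>)"
    and "marked_reduced_groebner_basis (rat_order \<omega>) I G"
  shows "(\<nexists>s. s 0 = Walk None G \<and> (\<forall>i::nat. walk_step I \<omega> \<tau> (s i) (s (Suc i)))) \<and>
    (\<forall>s. (walk_step I \<omega> \<tau>)\<^sup>*\<^sup>* (Walk None G) s \<longrightarrow>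
       (\<exists>G'. s = Output G') \<or> (\<exists>s'. walk_step I \<omega> \<tau> s s')) \<and>
    (\<forall>G'. (walk_step I \<omega> \<tau>)\<^sup>*\<^sup>* (Walk None G) (Output G') \<longrightarrow>
       marked_reduced_groebner_basis (rat_order \<tau>) I G')"
proof -
  interpret generic_walk I \<omega> \<tau> by unfold_locales (fact assms)+
  have start: "walk_inv (Walk None G)" using assms(6) by (simp add: position_def)
  show ?thesis
  proof (intro conjI allI impI notI)
    assume "\<exists>s. s 0 = Walk None G \<and> (\<forall>i::nat. walk_step I \<omega> \<tau> (s i) (s (Suc i)))"
    then show False using walk_terminates assms(6) by blast
  next
    fix s assume "(walk_step I \<omega> \<tau>)\<^sup>*\<^sup>* (Walk None G) s"
    then show "(\<exists>G'. s = Output G') \<or> (\<exists>s'. walk_step I \<omega> \<tau> s s')"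
      using walk_inv_progress walk_inv_steps start by blast
  next
    fix G' assume "(walk_step I \<omega> \<tau>)\<^sup>*\<^sup>* (Walk None G) (Output G')"
    then have "walk_inv (Output G')" using walk_inv_steps start by blast
    then show "marked_reduced_groebner_basis (rat_order \<tau>) I G'" by simp
  qed
qed

end
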